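(* Let $\beta\in\{1,2,4\}$ and for each $N\ge1$ let $\lambda_1,\dots,\lambda_N>0$ have joint density proportional to $\prod_{i<j}|\lambda_i-\lambda_j|^{\beta}\prod_{k=1}^N\lambda_k^{\beta N/2}e^{-\beta N\lambda_k/2}$ on $(0,\infty)^N$. For $\kappa\ge0$ let $\mathcal{T}_\kappa=\frac1N\sum_{i=1}^N\lambda_i^{-\kappa}$ (this equals $N^{\kappa-1}\mathrm{Tr}\,Q^\kappa$ for the Wigner–Smith time-delay matrix $Q$ with eigenvalues $\tau_i=(N\lambda_i)^{-1}$), and for $v\ge1$ and $\kappa_1,\dots,\kappa_v\ge0$ define $$\alpha[\kappa_1,\dots,\kappa_v]=\beta^{v-1}\lim_{N\to\infty}N^{2(v-1)}C_v(\mathcal{T}_{\kappa_1},\dots,\mathcal{T}_{\kappa_v}),$$ which is independent of $\beta$. Then: (i) $\alpha[\kappa]\in\mathbb{N}$ for all $\kappa\ge0$; (ii) $\alpha[\kappa_1,\kappa_2]\in\mathbb{N}$ for all $\kappa_1,\kappa_2\ge0$; (iii) $\alpha[\kappa_1,\kappa_2,\kappa_3]\in\mathbb{N}$ for all $\kappa_1,\kappa_2,\kappa_3\ge0$; (iv) $\alpha[1,1,\dots,1]\in\mathbb{N}$ ($v$ entries equal to $1$) for all $v\ge1$.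
   Context: $C_v(\xi_1,\dots,\xi_v)$ denotes the joint cumulant: $C_v(\xi_1,\dots,\xi_v)=\sum_{\pi}(|\pi|-1)!(-1)^{|\pi|-1}\prod_{P\in\pi}\langle\prod_{i\in P}\xi_i\rangle$, summed over set partitions $\pi$ of $\{1,\dots,v\}$, with $\langle\cdot\rangle$ the expectation. The existence of the limits and the independence of $\alpha$ from $\beta$ are part of the setting. $\mathbb{N}$ denotes the nonnegative integers. *)

theory Defs
  imports "HOL-Analysis.Analysis" "HOL-Library.Disjoint_Sets"
begin

definition ws_weight :: "real \<Rightarrow> nat \<Rightarrow> (nat \<Rightarrow> real) \<Rightarrow> real" where
  "ws_weight \<beta> N x =
     (if (\<forall>k<N. x k > 0) then
        (\<Prod>i<N. \<Prod>j\<in>{i<..<N}. \<bar>x i - x j\<bar> powr \<beta>) *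
        (\<Prod>k<N. x k powr (\<beta> * real N / 2) * exp (- \<beta> * real N * x k / 2))
      else 0)"

definition ws_space :: "nat \<Rightarrow> (nat \<Rightarrow> real) measure" where
  "ws_space N = PiM {..<N} (\<lambda>_. lborel)"

definition ws_expect :: "real \<Rightarrow> nat \<Rightarrow> ((nat \<Rightarrow> real) \<Rightarrow> real) \<Rightarrow> real" where
  "ws_expect \<beta> N f =
     (\<integral>x. f x * ws_weight \<beta> N x \<partial>ws_space N) / (\<integral>x. ws_weight \<beta> N x \<partial>ws_space N)"

definition ws_T :: "nat \<Rightarrow> nat \<Rightarrow> (nat \<Rightarrow> real) \<Rightarrow> real" where
  "ws_T \<kappa> N x = (1 / real N) * (\<Sum>i<N. 1 / x i ^ \<kappa>)"

definition ws_cumulant :: "real \<Rightarrow> nat \<Rightarrow> nat list \<Rightarrow> real" where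
  "ws_cumulant \<beta> N ks =
     (\<Sum>\<pi>\<in>{\<pi>. partition_on {..<length ks} \<pi>}.
        fact (card \<pi> - 1) * (-1) ^ (card \<pi> - 1) *
        (\<Prod>P\<in>\<pi>. ws_expect \<beta> N (\<lambda>x. \<Prod>i\<in>P. ws_T (ks ! i) N x)))"

definition alpha_in_Nat :: "real \<Rightarrow> nat list \<Rightarrow> bool" where
  "alpha_in_Nat \<beta> ks \<longleftrightarrow>
     (\<exists>m::nat. (\<lambda>N. \<beta> ^ (length ks - 1) * real N ^ (2 * (length ks - 1)) * ws_cumulant \<beta> N ks)
                  \<longlonglongrightarrow> real m)"

end

theory Submission
  imports Defs "HOL-Library.Multiset"
begin

text \<open>
  Integrating the divergence of the vector field with components \<open>x\<^sub>i\<^sup>-\<^sup>k \<Prod>\<^sub>j T\<^bsub>\<kappa> j\<^esub>\<close> against the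
  density gives a loop equation expressing \<open>E[T\<^bsub>k+1\<^esub> \<Prod>\<^sub>j T\<^bsub>\<kappa> j\<^esub>]\<close> by moments of the same or lower
  total degree. For the rescaled joint cumulants \<open>c = (\<beta> N\<^sup>2)\<^bsup>v-1\<^esup> C\<^sub>v\<close> it becomes
  \<open>(1 + k (1 - 2/\<beta>) / N) c[k+1, S] = c[k, S]
     + \<Sum>\<^bsub>a+b=k+1\<^esub> (c[a, b, S] / (\<beta> N\<^sup>2) + \<Sum>\<^bsub>I \<subseteq> S\<^esub> c[a, I] c[b, S - I])
     + 2 \<Sum>\<^bsub>j \<in> S\<^esub> \<kappa>\<^sub>j c[\<kappa>\<^sub>j + k + 1, S - j]\<close>,
  where a and b are positive.
  In the limit the terms \<open>c[a, b, S]\<close> disappear and what remains is a recursion with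
  coefficients in the natural numbers, so all limits, for every v, are natural numbers.
\<close>

section \<open>Joint cumulants\<close>

text \<open>The limiting recursion is well-founded for total degree first and number of entries
  second: c[\<kappa>_j + k + 1, S - j] keeps the degree and loses an entry, every other cumulant on
  the right has smaller degree. At finite N the equation is not closed in this order, because
  c[a, b, S] keeps the degree and gains an entry, and no bound on these cumulants is known
  beforehand. The recursion starts from a zero entry: T_0 = 1 has cumulant 1 alone and 0 jointly
  with anything else.

  Moments of degree d exist only if N is large compared with d, since the density vanishes at x_i =
  0 only to order \<beta> N / 2; every equation is therefore stated for large N at fixed degree.

  Moments are replaced by cumulants without generating functions: the moment equations for all
  subfamilies are the convolutions of the cumulant equations with the moments over subsets, and this
  convolution is invertible because the empty moment is 1.

  The term k (1 - 2/\<beta>) / N joins the derivative of x_i^(-k) to the diagonal of the symmetrised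
  interaction. It and 1 / (\<beta> N^2) are the only places where \<beta> remains after rescaling,
  and both vanish in the limit.\<close>

definition cum :: "('a set \<Rightarrow> real) \<Rightarrow> 'a set \<Rightarrow> real" where
  "cum m S = (\<Sum>\<pi>\<in>{\<pi>. partition_on S \<pi>}.
     fact (card \<pi> - 1) * (-1) ^ (card \<pi> - 1) * (\<Prod>P\<in>\<pi>. m P))"

lemma partition_on_insert_complement:
  assumes "partition_on I \<pi>" "I \<subseteq> S" "I \<noteq> S"
  shows "partition_on S (insert (S - I) \<pi>)"
  using assms unfolding partition_on_def disjoint_def by auto

lemma partition_on_remove_block:
  assumes "partition_on S \<rho>" "B \<in> \<rho>"
  shows "partition_on (S - B) (\<rho> - {B})"
proof -
  have S: "S = \<Union>\<rho>" and dis: "\<And>P Q. P \<in> \<rho> \<Longrightarrow> Q \<in> \<rho> \<Longrightarrow> P \<noteq> Q \<Longrightarrow> P \<inter> Q = {}" and ne: "{} \<notin> \<rho>"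
    using assms(1) by (auto simp: partition_on_def disjoint_def)
  have "\<Union>(\<rho> - {B}) = S - B" using S dis[OF _ assms(2)] by auto
  then show ?thesis using dis ne by (auto simp: partition_on_def disjoint_def)
qed

lemma card_blocks_avoiding:
  assumes "partition_on S \<rho>" "s \<in> S" "finite S"
  shows "card {B\<in>\<rho>. s \<notin> B} = card \<rho> - 1"
proof -
  obtain B0 where B0: "B0 \<in> \<rho>" "s \<in> B0"
    using assms unfolding partition_on_def by blast
  have "P \<inter> B0 = {}" if "P \<in> \<rho>" "P \<noteq> B0" for P
    using assms(1) B0(1) that by (auto simp: partition_on_def disjoint_def)
  then have "{B\<in>\<rho>. s \<notin> B} = \<rho> - {B0}"
    using B0 by auto
  then show ?thesis using B0 by simp
qed

text \<open>
  A proper subset I and a partition of \<^term>\<open>insert s I\<close> correspond to a partition of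
  \<^term>\<open>insert s S\<close> with a marked block avoiding \<^term>\<open>s\<close>. Since a partition into n blocks has
  n - 1 such blocks, all coefficients cancel except that of the one-block partition.
\<close>
lemma moment_eq_sum_cum:
  fixes m :: "'a set \<Rightarrow> real"
  assumes fin: "finite S" and s: "s \<notin> S" and m0: "m {} = 1"
  shows "m (insert s S) = (\<Sum>I\<in>Pow S. cum m (insert s I) * m (S - I))"
proof -
  define mu :: "nat \<Rightarrow> real" where "mu n = fact (n - 1) * (-1) ^ (n - 1)" for n
  define T where "T = insert s S"
  define PT where "PT = {\<pi>. partition_on T \<pi>}"
  have finT: "finite T" using fin by (simp add: T_def)
  have finPT: "finite PT" unfolding PT_def by (rule finitely_many_partition_on[OF finT])
  have cumT: "cum m T = (\<Sum>\<rho>\<in>PT. mu (card \<rho>) * (\<Prod>P\<in>\<rho>. m P))"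
    by (simp add: cum_def PT_def mu_def)
  \<comment> \<open>I = S is kept apart: its complement is empty and cannot be a marked block. It
    contributes the whole cumulant of T and comes back in \<open>eq\<close>.\<close>
  have "(\<Sum>I\<in>Pow S - {S}. cum m (insert s I) * m (S - I))
      = (\<Sum>I\<in>Pow S - {S}. \<Sum>\<pi>\<in>{\<pi>. partition_on (insert s I) \<pi>}.
            mu (card \<pi>) * (\<Prod>P\<in>\<pi>. m P) * m (S - I))"
    by (simp add: cum_def mu_def sum_distrib_right)
  also have "\<dots> = (\<Sum>(I,\<pi>)\<in>(SIGMA I:Pow S - {S}. {\<pi>. partition_on (insert s I) \<pi>}).
            mu (card \<pi>) * (\<Prod>P\<in>\<pi>. m P) * m (S - I))"
    using fin by (subst sum.Sigma) (auto intro!: finitely_many_partition_on intro: finite_subset)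
  also have "\<dots> = (\<Sum>(\<rho>,B)\<in>(SIGMA \<rho>:PT. {B\<in>\<rho>. s \<notin> B}). mu (card \<rho> - 1) * (\<Prod>P\<in>\<rho>. m P))"
  proof (rule sum.reindex_bij_witness[where
        i = "\<lambda>(\<rho>,B). (S - B, \<rho> - {B})" and j = "\<lambda>(I,\<pi>). (insert (S - I) \<pi>, S - I)"], goal_cases)
    case (1 a)
    obtain I \<pi> where a: "a = (I, \<pi>)" by (cases a)
    with 1 have I: "I \<subseteq> S" "I \<noteq> S" and p: "partition_on (insert s I) \<pi>" by auto
    have "S - I \<notin> \<pi>"
    proof
      assume "S - I \<in> \<pi>"
      then have "S - I \<subseteq> insert s I" using p by (auto simp: partition_on_def)
      then show False using I s by auto
    qed
    then show ?case using I by (auto simp: a)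
  next
    case (2 a)
    obtain I \<pi> where a: "a = (I, \<pi>)" by (cases a)
    with 2 have I: "I \<subseteq> S" "I \<noteq> S" and p: "partition_on (insert s I) \<pi>" by auto
    have "partition_on T (insert (T - insert s I) \<pi>)"
      using I s by (intro partition_on_insert_complement[OF p]) (auto simp: T_def)
    moreover have "T - insert s I = S - I" using s by (auto simp: T_def)
    ultimately show ?case using s by (auto simp: a PT_def)
  next
    case (3 b)
    obtain \<rho> B where b: "b = (\<rho>, B)" by (cases b)
    with 3 have r: "partition_on T \<rho>" and B: "B \<in> \<rho>" "s \<notin> B" by (auto simp: PT_def)
    have "B \<subseteq> T" using r B unfolding partition_on_def by blast
    then have "B \<subseteq> S" using B by (auto simp: T_def)
    then have "S - (S - B) = B" by auto
    then show ?case using B by (simp add: b insert_absorb)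
  next
    case (4 b)
    obtain \<rho> B where b: "b = (\<rho>, B)" by (cases b)
    with 4 have r: "partition_on T \<rho>" and B: "B \<in> \<rho>" "s \<notin> B" by (auto simp: PT_def)
    have "B \<subseteq> T" "B \<noteq> {}" using r B unfolding partition_on_def by blast+
    then have BS: "B \<subseteq> S" "S - B \<noteq> S" using B by (auto simp: T_def)
    have "T - B = insert s (S - B)" using B by (auto simp: T_def)
    then show ?case using BS partition_on_remove_block[OF r B(1)] by (auto simp: b)
  next
    case (5 a)
    obtain I \<pi> where a: "a = (I, \<pi>)" by (cases a)
    with 5 have I: "I \<subseteq> S" "I \<noteq> S" and p: "partition_on (insert s I) \<pi>" by auto
    have ni: "S - I \<notin> \<pi>"
    proof
      assume "S - I \<in> \<pi>"
      then have "S - I \<subseteq> insert s I" using p by (auto simp: partition_on_def)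
      then show False using I s by auto
    qed
    have "finite \<pi>" using p fin I by (meson finite_elements finite_insert finite_subset)
    then show ?case using ni by (simp add: a)
  qed
  also have "\<dots> = (\<Sum>\<rho>\<in>PT. \<Sum>B\<in>{B\<in>\<rho>. s \<notin> B}. mu (card \<rho> - 1) * (\<Prod>P\<in>\<rho>. m P))"
    using finPT finite_elements[OF finT] by (subst sum.Sigma) (auto simp: PT_def)
  also have "\<dots> = (\<Sum>\<rho>\<in>PT. real (card \<rho> - 1) * mu (card \<rho> - 1) * (\<Prod>P\<in>\<rho>. m P))"
  proof (rule sum.cong[OF refl])
    fix \<rho> assume "\<rho> \<in> PT"
    then have "card {B\<in>\<rho>. s \<notin> B} = card \<rho> - 1"
      using finT by (intro card_blocks_avoiding[of T]) (auto simp: PT_def T_def)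
    then show "(\<Sum>B\<in>{B\<in>\<rho>. s \<notin> B}. mu (card \<rho> - 1) * (\<Prod>P\<in>\<rho>. m P))
        = real (card \<rho> - 1) * mu (card \<rho> - 1) * (\<Prod>P\<in>\<rho>. m P)"
      by simp
  qed
  finally have eq: "(\<Sum>I\<in>Pow S. cum m (insert s I) * m (S - I))
      = (\<Sum>\<rho>\<in>PT. (mu (card \<rho>) + real (card \<rho> - 1) * mu (card \<rho> - 1)) * (\<Prod>P\<in>\<rho>. m P))"
    using fin cumT m0
    by (subst sum.remove[of _ S]) (auto simp: T_def sum.distrib algebra_simps)
  also have "\<dots> = (\<Sum>\<rho>\<in>PT. if \<rho> = {T} then m T else 0)"
  proof (rule sum.cong[OF refl])
    fix \<rho> assume "\<rho> \<in> PT"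
    then have r: "partition_on T \<rho>" by (simp add: PT_def)
    have fr: "finite \<rho>" using finT r by (rule finite_elements)
    have ne: "\<rho> \<noteq> {}" using r unfolding partition_on_def T_def by auto
    show "(mu (card \<rho>) + real (card \<rho> - 1) * mu (card \<rho> - 1)) * (\<Prod>P\<in>\<rho>. m P)
        = (if \<rho> = {T} then m T else 0)"
    proof (cases "card \<rho> = 1")
      case True
      then obtain B where "\<rho> = {B}" by (auto simp: card_1_singleton_iff)
      then have "\<rho> = {T}" using r unfolding partition_on_def by auto
      then show ?thesis by (simp add: mu_def)
    next
      case False
      moreover have "card \<rho> \<noteq> 0" using fr ne by simp
      ultimately obtain n where n: "card \<rho> = Suc (Suc n)"
        by (metis One_nat_def not0_implies_Suc)
      then have "\<rho> \<noteq> {T}" by auto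
      \<comment> \<open>(n + 1)! (-1)^(n + 1) + (n + 1) n! (-1)^n = 0.\<close>
      then show ?thesis by (simp add: n mu_def)
    qed
  qed
  also have "\<dots> = m T"
    using finPT partition_on_space[of T] by (simp add: PT_def T_def)
  finally show ?thesis by (simp add: T_def)
qed

lemma partition_on_image_inj:
  assumes "inj_on f A" "partition_on A \<pi>"
  shows "partition_on (f ` A) ((`) f ` \<pi>)"
proof -
  have "(`) f ` \<pi> - {{}} = (`) f ` \<pi>" using assms(2) by (auto simp: partition_on_def)
  then show ?thesis using partition_on_inj_image[OF assms(2,1)] by simp
qed

lemma cum_reindex:
  assumes f: "bij_betw f A B" and fin: "finite A"
  shows "cum m B = cum (\<lambda>P. m (f ` P)) A"
proof -
  have inj: "inj_on f A" and B: "B = f ` A" using f by (auto simp: bij_betw_def)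
  define g where "g = the_inv_into A f"
  have g: "inj_on g B" "A = g ` B" "\<And>a. a \<in> A \<Longrightarrow> g (f a) = a" "\<And>b. b \<in> B \<Longrightarrow> f (g b) = b"
    using f the_inv_into_f_f[OF inj] f_the_inv_into_f[OF inj]
      bij_betw_the_inv_into[OF f] by (auto simp: g_def bij_betw_def)
  have gf: "g ` f ` P = P" if "P \<subseteq> A" for P
    using that g(3) by (force simp: image_image)
  have fg: "f ` g ` P = P" if "P \<subseteq> B" for P
    using that g(4) by (force simp: image_image)
  have sub: "P \<subseteq> X" if "partition_on X \<pi>" "P \<in> \<pi>" for P and X :: "'c set" and \<pi>
    using that unfolding partition_on_def by blast
  have gfp: "(`) g ` (`) f ` \<pi> = \<pi>" if "partition_on A \<pi>" for \<pi>
  proof -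
    have "(`) g ` (`) f ` \<pi> = (\<lambda>P. P) ` \<pi>"
      unfolding image_image[of "(`) g"] by (rule image_cong[OF refl]) (rule gf, rule sub[OF that])
    then show ?thesis by simp
  qed
  have fgp: "(`) f ` (`) g ` \<pi> = \<pi>" if "partition_on B \<pi>" for \<pi>
  proof -
    have "(`) f ` (`) g ` \<pi> = (\<lambda>P. P) ` \<pi>"
      unfolding image_image[of "(`) f"] by (rule image_cong[OF refl]) (rule fg, rule sub[OF that])
    then show ?thesis by simp
  qed
  show ?thesis unfolding cum_def
  proof (rule sum.reindex_bij_witness[where i = "\<lambda>\<pi>. (`) f ` \<pi>" and j = "\<lambda>\<pi>. (`) g ` \<pi>"], goal_cases)
    case (1 \<pi>) then show ?case using fgp by simp
  next
    case (2 \<pi>) then show ?case using partition_on_image_inj[of g B \<pi>] g by auto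
  next
    case (3 \<pi>) then show ?case using gfp by simp
  next
    case (4 \<pi>) then show ?case using partition_on_image_inj[of f A \<pi>] inj B by auto
  next
    case (5 \<pi>)
    then have p: "partition_on B \<pi>" by simp
    have fgP: "f ` g ` P = P" if "P \<in> \<pi>" for P by (rule fg, rule sub[OF p that])
    have inj': "inj_on ((`) g) \<pi>" by (rule inj_on_inverseI[where g = "(`) f"]) (rule fgP)
    have "(\<Prod>P\<in>(`) g ` \<pi>. m (f ` P)) = (\<Prod>P\<in>\<pi>. m P)"
      unfolding prod.reindex[OF inj'] o_def by (rule prod.cong[OF refl]) (simp only: fgP)
    then show ?case by (simp only: card_image[OF inj'])
  qed
qed

lemma Pow_insert_sum:
  assumes "finite S" "s \<notin> S"
  shows "(\<Sum>I\<in>Pow (insert s S). f I) = (\<Sum>I\<in>Pow S. f I + f (insert s I))"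
proof -
  have "(\<Sum>I\<in>insert s ` Pow S. f I) = (\<Sum>I\<in>Pow S. f (insert s I))"
    using assms by (subst sum.reindex) (auto simp: inj_on_def)
  then show ?thesis
    unfolding Pow_insert sum.distrib using assms by (subst sum.union_disjoint) auto
qed

text \<open>As \<open>m {} = 1\<close>, the term I = S of the convolution is \<open>f S\<close>
  itself, and the others involve proper subsets, so the values of f are determined one after
  another. Identities between cumulants can thus be checked after convolution with the moments,
  without expanding set partitions.\<close>

lemma subset_convolution_unique:
  fixes m :: "'a set \<Rightarrow> real"
  assumes "finite S" "m {} = 1"
    and "\<And>R. R \<subseteq> S \<Longrightarrow> (\<Sum>I\<in>Pow R. f I * m (R - I)) = (\<Sum>I\<in>Pow R. g I * m (R - I))"
  shows "f S = g S"
  using assms(1,3)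
proof (induction S rule: finite_psubset_induct)
  case (psubset S)
  have "f I = g I" if "I \<in> Pow S - {S}" for I
    by (rule psubset.IH) (use that psubset.prems in auto)
  then have "(\<Sum>I\<in>Pow S - {S}. f I * m (S - I)) = (\<Sum>I\<in>Pow S - {S}. g I * m (S - I))"
    by simp
  then show ?case
    using psubset.prems[of S] psubset.hyps assms(2) by (simp add: sum.remove[of _ S])
qed

section \<open>Cumulants indexed by multisets of exponents\<close>

text \<open>Moments and cumulants depend only on which exponents occur and how often. The index set
  S is kept because its subsets tell equal exponents apart, which submultisets would not.\<close>

definition mset_on :: "('i \<Rightarrow> 'a) \<Rightarrow> 'i set \<Rightarrow> 'a multiset" where
  "mset_on \<kappa> S = image_mset \<kappa> (mset_set S)"

lemma mset_on_empty [simp]: "mset_on \<kappa> {} = {#}"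
  by (simp add: mset_on_def)

lemma mset_on_insert [simp]:
  "finite S \<Longrightarrow> s \<notin> S \<Longrightarrow> mset_on \<kappa> (insert s S) = add_mset (\<kappa> s) (mset_on \<kappa> S)"
  by (simp add: mset_on_def)

lemma mset_on_cong: "(\<And>i. i \<in> S \<Longrightarrow> \<kappa> i = \<kappa>' i) \<Longrightarrow> mset_on \<kappa> S = mset_on \<kappa>' S"
  unfolding mset_on_def by (rule image_mset_cong) (metis elem_mset_set mset_set.infinite empty_iff set_mset_empty)

lemma mset_on_image: "inj_on f S \<Longrightarrow> mset_on \<kappa> (f ` S) = mset_on (\<kappa> \<circ> f) S"
  by (simp add: mset_on_def image_mset_mset_set[symmetric] multiset.map_comp)

lemma mset_on_nth: "mset_on (\<lambda>i. xs ! i) {..<length xs} = mset xs"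
proof -
  have "mset_on (\<lambda>i. xs ! i) {..<length xs} = mset (map (\<lambda>i. xs ! i) [0..<length xs])"
    by (simp add: mset_on_def lessThan_atLeast0)
  then show ?thesis by (simp add: map_nth)
qed

text \<open>The positions in the sorted list serve as labels of the variables; by
  \<open>cum_mset_on\<close> another labelling gives the same number.\<close>

definition mcum :: "('a::linorder multiset \<Rightarrow> real) \<Rightarrow> 'a multiset \<Rightarrow> real" where
  "mcum m A = cum (\<lambda>P. m (mset_on (\<lambda>i. sorted_list_of_multiset A ! i) P)) {..<size A}"

lemma cum_mset_on:
  fixes \<kappa> :: "'i::linorder \<Rightarrow> 'a::linorder"
  assumes fin: "finite S"
  shows "cum (\<lambda>P. m (mset_on \<kappa> P)) S = mcum m (mset_on \<kappa> S)"
proof -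
  \<comment> \<open>Listing S by increasing \<kappa> makes the exponents along \<open>ys\<close>
    exactly the sorted list that defines \<open>mcum\<close>.\<close>
  define ys where "ys = sort_key \<kappa> (sorted_list_of_set S)"
  define A where "A = mset_on \<kappa> S"
  have ys: "set ys = S" "distinct ys" using fin by (auto simp: ys_def)
  have mys: "mset (map \<kappa> ys) = A"
    using mset_set_set[OF ys(2)] by (simp add: A_def mset_on_def ys(1))
  have "sorted (map \<kappa> ys)" by (simp add: ys_def)
  then have xs: "sorted_list_of_multiset A = map \<kappa> ys"
    unfolding mys[symmetric] sorted_list_of_multiset_mset by (simp add: sort_key_id_if_sorted)
  have n: "size A = length ys" using mys by (metis length_map size_mset)
  have bij: "bij_betw ((!) ys) {..<length ys} S"
    using ys bij_betw_nth by blast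
  have "cum (\<lambda>P. m (mset_on \<kappa> P)) S = cum (\<lambda>P. m (mset_on \<kappa> ((!) ys ` P))) {..<length ys}"
    using bij by (rule cum_reindex) simp
  also have "\<dots> = mcum m A" unfolding mcum_def n xs cum_def
  proof (rule sum.cong[OF refl], rule arg_cong2[where f="(*)"], rule refl, rule prod.cong[OF refl])
    fix \<pi> P assume "\<pi> \<in> {\<pi>. partition_on {..<length ys} \<pi>}" "P \<in> \<pi>"
    then have P: "P \<subseteq> {..<length ys}" by (auto simp: partition_on_def)
    then have "inj_on ((!) ys) P" using bij by (meson bij_betw_def inj_on_subset)
    then have "mset_on \<kappa> ((!) ys ` P) = mset_on (\<kappa> \<circ> (!) ys) P" by (rule mset_on_image)
    also have "\<dots> = mset_on ((!) (map \<kappa> ys)) P" using P by (intro mset_on_cong) auto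
    finally show "m (mset_on \<kappa> ((!) ys ` P)) = m (mset_on ((!) (map \<kappa> ys)) P)" by simp
  qed
  finally show ?thesis by (simp add: A_def)
qed

lemma moment_eq_sum_mcum:
  fixes \<kappa> :: "nat \<Rightarrow> 'a::linorder"
  assumes fin: "finite S" and m0: "m {#} = 1"
  shows "m (add_mset k (mset_on \<kappa> S))
       = (\<Sum>I\<in>Pow S. mcum m (add_mset k (mset_on \<kappa> I)) * m (mset_on \<kappa> (S - I)))"
proof -
  \<comment> \<open>A fresh label s carries the exponent k, so that the set version applies with s
    as its distinguished element.\<close>
  obtain s where s: "s \<notin> S" using fin ex_new_if_finite infinite_UNIV_nat by blast
  define \<kappa>' where "\<kappa>' = \<kappa>(s := k)"
  have k': "mset_on \<kappa>' I = mset_on \<kappa> I" if "I \<subseteq> S" for I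
    using that s by (intro mset_on_cong) (auto simp: \<kappa>'_def)
  have kk: "mset_on \<kappa>' (insert s I) = add_mset k (mset_on \<kappa> I)" if "I \<subseteq> S" for I
    using s k'[OF that] finite_subset[OF that fin] subsetD[OF that, of s]
    by (subst mset_on_insert) (auto simp: \<kappa>'_def)
  have "m (mset_on \<kappa>' (insert s S)) = (\<Sum>I\<in>Pow S. cum (\<lambda>P. m (mset_on \<kappa>' P)) (insert s I) * m (mset_on \<kappa>' (S - I)))"
    by (rule moment_eq_sum_cum[OF fin s]) (simp add: m0)
  also have "\<dots> = (\<Sum>I\<in>Pow S. mcum m (add_mset k (mset_on \<kappa> I)) * m (mset_on \<kappa> (S - I)))"
  proof (rule sum.cong[OF refl])
    fix I assume "I \<in> Pow S"
    then have I: "I \<subseteq> S" by simp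
    then have "finite (insert s I)" using fin by (simp add: finite_subset)
    then have "cum (\<lambda>P. m (mset_on \<kappa>' P)) (insert s I) = mcum m (add_mset k (mset_on \<kappa> I))"
      using kk[OF I] cum_mset_on by metis
    then show "cum (\<lambda>P. m (mset_on \<kappa>' P)) (insert s I) * m (mset_on \<kappa>' (S - I)) =
      mcum m (add_mset k (mset_on \<kappa> I)) * m (mset_on \<kappa> (S - I))"
      using k'[of "S - I"] by simp
  qed
  finally show ?thesis using kk[of S] by simp
qed

text \<open>A variable that can be adjoined without changing any moment behaves like the constant 1:
  the indicator of the empty set solves the same convolution equation as its cumulants. The use is
  for the exponent 0, where \<open>ws_T\<close> is identically 1.\<close>

lemma mcum_trivial_variable:
  fixes k :: "'a::linorder"
  assumes m0: "m {#} = 1" and mk: "\<And>A. m (add_mset k A) = m A"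
  shows "mcum m (add_mset k A) = (if A = {#} then 1 else 0)"
proof -
  obtain xs where xs: "A = mset xs" by (metis ex_mset)
  define \<kappa> where "\<kappa> = (\<lambda>i. xs ! i)"
  define S where "S = {..<length xs}"
  have A: "A = mset_on \<kappa> S" by (simp add: xs S_def \<kappa>_def mset_on_nth)
  have "mcum m (add_mset k (mset_on \<kappa> S)) = (if S = {} then 1 else 0)"
  proof (rule subset_convolution_unique[where f = "\<lambda>S. mcum m (add_mset k (mset_on \<kappa> S))"
        and g = "\<lambda>S. if S = {} then 1 else 0" and m = "\<lambda>S. m (mset_on \<kappa> S)"])
    fix R assume R: "R \<subseteq> S"
    then have fin: "finite R" by (auto simp: S_def finite_subset)
    have "(\<Sum>I\<in>Pow R. (if I = {} then 1 else 0) * m (mset_on \<kappa> (R - I)))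
        = (\<Sum>I\<in>Pow R. if I = {} then m (mset_on \<kappa> R) else 0)"
      by (rule sum.cong) auto
    also have "\<dots> = m (mset_on \<kappa> R)" using fin by simp
    finally show "(\<Sum>I\<in>Pow R. mcum m (add_mset k (mset_on \<kappa> I)) * m (mset_on \<kappa> (R - I)))
        = (\<Sum>I\<in>Pow R. (if I = {} then 1 else 0) * m (mset_on \<kappa> (R - I)))"
      using moment_eq_sum_mcum[of R m k \<kappa>, OF fin m0] mk by simp
  qed (auto simp: S_def m0)
  then show ?thesis by (simp add: A[symmetric]) (auto simp: S_def xs lessThan_empty_iff)
qed

text \<open>This is the rule \<open>C(XY, S) = C(X, Y, S) + \<Sum>\<^bsub>I \<subseteq> S\<^esub> C(X, I) C(Y, S - I)\<close>, convolved with the moments.\<close>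
lemma moment_pair_eq_sum_mcum:
  fixes \<kappa> :: "nat \<Rightarrow> 'a::linorder"
  assumes fin: "finite S" and m0: "m {#} = 1"
  shows "m (add_mset a (add_mset b (mset_on \<kappa> S)))
       = (\<Sum>R\<in>Pow S. (mcum m (add_mset a (add_mset b (mset_on \<kappa> R)))
            + (\<Sum>I\<in>Pow R. mcum m (add_mset a (mset_on \<kappa> I)) * mcum m (add_mset b (mset_on \<kappa> (R - I)))))
          * m (mset_on \<kappa> (S - R)))"
proof -
  obtain s where s: "s \<notin> S" using fin ex_new_if_finite infinite_UNIV_nat by blast
  define \<kappa>' where "\<kappa>' = \<kappa>(s := b)"
  have k': "mset_on \<kappa>' I = mset_on \<kappa> I" if "I \<subseteq> S" for I
    using that s by (intro mset_on_cong) (auto simp: \<kappa>'_def)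
  have kk: "mset_on \<kappa>' (insert s I) = add_mset b (mset_on \<kappa> I)" if "I \<subseteq> S" for I
    using s k'[OF that] finite_subset[OF that fin] subsetD[OF that, of s]
    by (subst mset_on_insert) (auto simp: \<kappa>'_def)
  have "m (add_mset a (add_mset b (mset_on \<kappa> S))) = m (add_mset a (mset_on \<kappa>' (insert s S)))"
    using kk[of S] by simp
  also have "\<dots> = (\<Sum>I\<in>Pow (insert s S). mcum m (add_mset a (mset_on \<kappa>' I)) * m (mset_on \<kappa>' (insert s S - I)))"
    by (rule moment_eq_sum_mcum) (use fin m0 in auto)
  also have "\<dots> = (\<Sum>I\<in>Pow S. mcum m (add_mset a (mset_on \<kappa> I)) * m (add_mset b (mset_on \<kappa> (S - I)))
       + mcum m (add_mset a (add_mset b (mset_on \<kappa> I))) * m (mset_on \<kappa> (S - I)))"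
  proof (subst Pow_insert_sum[OF fin s], rule sum.cong[OF refl], goal_cases)
    case (1 I)
    then have I: "I \<subseteq> S" by simp
    then have e: "insert s S - I = insert s (S - I)" "insert s S - insert s I = S - I" using s by auto
    show ?case using I e kk[of I] kk[of "S - I"] k'[of I] k'[of "S - I"] by simp
  qed
  \<comment> \<open>The moments that still contain b are expanded once more; the labels I joined to
    a and J joined to b are then collected into R = I \<union> J.\<close>
  also have "(\<Sum>I\<in>Pow S. mcum m (add_mset a (mset_on \<kappa> I)) * m (add_mset b (mset_on \<kappa> (S - I)))
       + mcum m (add_mset a (add_mset b (mset_on \<kappa> I))) * m (mset_on \<kappa> (S - I)))
     = (\<Sum>I\<in>Pow S. \<Sum>J\<in>Pow (S - I). mcum m (add_mset a (mset_on \<kappa> I))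
           * mcum m (add_mset b (mset_on \<kappa> J)) * m (mset_on \<kappa> (S - I - J)))
      + (\<Sum>I\<in>Pow S. mcum m (add_mset a (add_mset b (mset_on \<kappa> I))) * m (mset_on \<kappa> (S - I)))"
    using moment_eq_sum_mcum[of "S - _" m b \<kappa>] fin m0
    by (simp add: sum.distrib sum_distrib_left mult.assoc)
  also have "(\<Sum>I\<in>Pow S. \<Sum>J\<in>Pow (S - I). mcum m (add_mset a (mset_on \<kappa> I))
           * mcum m (add_mset b (mset_on \<kappa> J)) * m (mset_on \<kappa> (S - I - J)))
     = (\<Sum>R\<in>Pow S. \<Sum>I\<in>Pow R. mcum m (add_mset a (mset_on \<kappa> I))
           * mcum m (add_mset b (mset_on \<kappa> (R - I))) * m (mset_on \<kappa> (S - R)))"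
  proof -
    have fR: "finite R" if "R \<subseteq> S" for R using that fin finite_subset by blast
    have "(\<Sum>(I, J)\<in>(SIGMA I:Pow S. Pow (S - I)). mcum m (add_mset a (mset_on \<kappa> I))
           * mcum m (add_mset b (mset_on \<kappa> J)) * m (mset_on \<kappa> (S - I - J)))
       = (\<Sum>(R, I)\<in>(SIGMA R:Pow S. Pow R). mcum m (add_mset a (mset_on \<kappa> I))
           * mcum m (add_mset b (mset_on \<kappa> (R - I))) * m (mset_on \<kappa> (S - R)))"
    proof (rule sum.reindex_bij_witness[where i = "\<lambda>(R,I). (I, R - I)" and j = "\<lambda>(I,J). (I \<union> J, I)"], goal_cases)
      case (5 p)
      obtain I J where p: "p = (I, J)" by (cases p)
      with 5 have "I \<union> J - I = J" "S - (I \<union> J) = S - I - J" by auto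
      then show ?case by (simp add: p)
    qed auto
    then show ?thesis
      using fin fR by (simp add: sum.Sigma)
  qed
  finally show ?thesis
    by (simp add: sum.distrib distrib_right sum_distrib_right add.commute)
qed

text \<open>Convolved with the moments, the claimed equation becomes \<open>loop\<close>: the
  quadratic terms by \<open>moment_pair_eq_sum_mcum\<close>, the others by
  \<open>moment_eq_sum_mcum\<close>. The inversion runs through all smaller families, so
  \<open>loop\<close> is required for every subset R of S.\<close>

lemma mcum_loop_equation:
  fixes m :: "nat multiset \<Rightarrow> real" and \<kappa> :: "nat \<Rightarrow> nat"
  assumes fin: "finite S" and m0: "m {#} = 1"
    and loop: "\<And>R. R \<subseteq> S \<Longrightarrow> r * m (add_mset (Suc k) (mset_on \<kappa> R)) =
       m (add_mset k (mset_on \<kappa> R))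
       + (\<Sum>c<k. m (add_mset (Suc c) (add_mset (k - c) (mset_on \<kappa> R))))
       + e * (\<Sum>j\<in>R. real (\<kappa> j) * m (add_mset (\<kappa> j + k + 1) (mset_on \<kappa> (R - {j}))))"
  shows "r * mcum m (add_mset (Suc k) (mset_on \<kappa> S)) =
       mcum m (add_mset k (mset_on \<kappa> S))
       + (\<Sum>c<k. mcum m (add_mset (Suc c) (add_mset (k - c) (mset_on \<kappa> S)))
           + (\<Sum>I\<in>Pow S. mcum m (add_mset (Suc c) (mset_on \<kappa> I)) * mcum m (add_mset (k - c) (mset_on \<kappa> (S - I)))))
       + e * (\<Sum>j\<in>S. real (\<kappa> j) * mcum m (add_mset (\<kappa> j + k + 1) (mset_on \<kappa> (S - {j}))))"
proof -
  define pair where "pair c R = mcum m (add_mset (Suc c) (add_mset (k - c) (mset_on \<kappa> R)))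
     + (\<Sum>I\<in>Pow R. mcum m (add_mset (Suc c) (mset_on \<kappa> I)) * mcum m (add_mset (k - c) (mset_on \<kappa> (R - I))))" for c R
  define d where "d j R = real (\<kappa> j) * mcum m (add_mset (\<kappa> j + k + 1) (mset_on \<kappa> R))" for j R
  define rhs where "rhs R = mcum m (add_mset k (mset_on \<kappa> R)) + (\<Sum>c<k. pair c R)
       + e * (\<Sum>j\<in>R. d j (R - {j}))" for R
  have "r * mcum m (add_mset (Suc k) (mset_on \<kappa> S)) = rhs S"
  proof (rule subset_convolution_unique[where f = "\<lambda>R. r * mcum m (add_mset (Suc k) (mset_on \<kappa> R))"
        and g = rhs and m = "\<lambda>R. m (mset_on \<kappa> R)", OF fin])
    fix R assume R: "R \<subseteq> S"
    then have finR: "finite R" using fin finite_subset by blast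
    have finI: "finite I" if "I \<subseteq> R" for I using that finR finite_subset by blast
    \<comment> \<open>Choosing I and a j in I amounts to choosing j first and then I - {j} inside R
      - {j}.\<close>
    have "(\<Sum>I\<in>Pow R. \<Sum>j\<in>I. d j (I - {j}) * m (mset_on \<kappa> (R - I)))
        = (\<Sum>j\<in>R. \<Sum>I\<in>Pow (R - {j}). d j I * m (mset_on \<kappa> (R - {j} - I)))"
    proof -
      have "(\<Sum>(I, j)\<in>(SIGMA I:Pow R. I). d j (I - {j}) * m (mset_on \<kappa> (R - I)))
          = (\<Sum>(j, I)\<in>(SIGMA j:R. Pow (R - {j})). d j I * m (mset_on \<kappa> (R - {j} - I)))"
      proof (rule sum.reindex_bij_witness[where i = "\<lambda>(j,I). (insert j I, j)" and j = "\<lambda>(I,j). (j, I - {j})"], goal_cases)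
        case (5 p)
        obtain I j where p: "p = (I, j)" by (cases p)
        with 5 have "R - {j} - (I - {j}) = R - I" by auto
        then show ?case by (simp add: p)
      qed auto
      then show ?thesis using finR finI by (simp add: sum.Sigma)
    qed
    also have "\<dots> = (\<Sum>j\<in>R. real (\<kappa> j) * m (add_mset (\<kappa> j + k + 1) (mset_on \<kappa> (R - {j}))))"
      using moment_eq_sum_mcum[of "R - {_}" m _ \<kappa>, OF _ m0] finR
      by (simp add: d_def sum_distrib_left mult.assoc)
    finally have d: "(\<Sum>I\<in>Pow R. \<Sum>j\<in>I. d j (I - {j}) * m (mset_on \<kappa> (R - I)))
        = (\<Sum>j\<in>R. real (\<kappa> j) * m (add_mset (\<kappa> j + k + 1) (mset_on \<kappa> (R - {j}))))" .
    have "(\<Sum>I\<in>Pow R. rhs I * m (mset_on \<kappa> (R - I)))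
        = (\<Sum>I\<in>Pow R. mcum m (add_mset k (mset_on \<kappa> I)) * m (mset_on \<kappa> (R - I)))
        + (\<Sum>I\<in>Pow R. \<Sum>c<k. pair c I * m (mset_on \<kappa> (R - I)))
        + e * (\<Sum>I\<in>Pow R. \<Sum>j\<in>I. d j (I - {j}) * m (mset_on \<kappa> (R - I)))"
      by (simp add: rhs_def sum.distrib distrib_right sum_distrib_left sum_distrib_right mult.assoc)
    also have "(\<Sum>I\<in>Pow R. \<Sum>c<k. pair c I * m (mset_on \<kappa> (R - I)))
        = (\<Sum>c<k. \<Sum>I\<in>Pow R. pair c I * m (mset_on \<kappa> (R - I)))"
      by (rule sum.swap)
    also have "\<dots> = (\<Sum>c<k. m (add_mset (Suc c) (add_mset (k - c) (mset_on \<kappa> R))))"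
      using moment_pair_eq_sum_mcum[of R m _ _ \<kappa>, OF finR m0] by (simp add: pair_def)
    also have "(\<Sum>I\<in>Pow R. mcum m (add_mset k (mset_on \<kappa> I)) * m (mset_on \<kappa> (R - I)))
        = m (add_mset k (mset_on \<kappa> R))"
      using moment_eq_sum_mcum[of R m k \<kappa>, OF finR m0] by simp
    finally have "(\<Sum>I\<in>Pow R. rhs I * m (mset_on \<kappa> (R - I)))
        = r * m (add_mset (Suc k) (mset_on \<kappa> R))"
      using loop[OF R] d by simp
    then show "(\<Sum>I\<in>Pow R. r * mcum m (add_mset (Suc k) (mset_on \<kappa> I)) * m (mset_on \<kappa> (R - I))) =
         (\<Sum>I\<in>Pow R. rhs I * m (mset_on \<kappa> (R - I)))"
      using moment_eq_sum_mcum[of R m "Suc k" \<kappa>, OF finR m0] by (simp add: sum_distrib_left mult.assoc)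
  qed (simp add: m0)
  then show ?thesis by (simp add: rhs_def pair_def d_def)
qed

section \<open>Limits of solutions of the loop equations\<close>

text \<open>Positive entries bound the number of entries by the degree; with zeros allowed there
  would be infinitely many unknowns of each degree.\<close>

lemma finite_positive_mset_sum: "finite {A :: nat multiset. 0 \<notin># A \<and> sum_mset A = d}"
proof -
  have "A \<in> mset ` {xs. set xs \<subseteq> {..d} \<and> length xs \<le> d}"
    if "0 \<notin># A" "sum_mset A = d" for A :: "nat multiset"
  proof -
    obtain xs where xs: "A = mset xs" by (metis ex_mset)
    have "length xs \<le> sum_list xs" if "0 \<notin> set xs" for xs :: "nat list"
      using that by (induction xs) auto
    then have "length xs \<le> d" "set xs \<subseteq> {..d}"
      using that member_le_sum_list[of _ xs] by (auto simp: xs sum_mset_sum_list)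
    then show ?thesis using xs by auto
  qed
  moreover have "finite (mset ` {xs. set xs \<subseteq> {..d} \<and> length xs \<le> d})"
    by (intro finite_imageI finite_lists_length_le) simp
  ultimately show ?thesis by (elim rev_finite_subset) blast
qed

lemma sum_mset_mset_on: "sum_mset (mset_on \<kappa> S) = (\<Sum>i\<in>S. \<kappa> i)"
  by (simp add: mset_on_def sum_unfold_sum_mset)

lemma size_mset_on: "size (mset_on \<kappa> S) = card S"
  by (simp add: mset_on_def)

lemma set_mset_mset_on: "finite S \<Longrightarrow> set_mset (mset_on \<kappa> S) = \<kappa> ` S"
  by (simp add: mset_on_def)

text \<open>
  In degree d the equations form a finite system whose coupling to multisets with more parts
  carries a vanishing factor. Errors are therefore measured relative to 1 + M, where M is the sum
  of the absolute values of all unknowns of degree d; at the end this forces M to be bounded.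
\<close>
lemma loop_equation_limits:
  fixes c :: "nat \<Rightarrow> nat multiset \<Rightarrow> real" and r :: "nat \<Rightarrow> nat \<Rightarrow> real" and \<epsilon> :: "nat \<Rightarrow> real"
  assumes r: "\<And>k. (\<lambda>N. r k N) \<longlonglongrightarrow> 1" and eps: "\<epsilon> \<longlonglongrightarrow> 0"
    and zero: "\<And>A. (\<lambda>N. c N (add_mset 0 A)) \<longlonglongrightarrow> (if A = {#} then 1 else 0)"
    and loop: "\<And>\<kappa> S k. finite S \<Longrightarrow> \<forall>\<^sub>F N in sequentially.
       r k N * c N (add_mset (Suc k) (mset_on \<kappa> S)) =
       c N (add_mset k (mset_on \<kappa> S))
       + (\<Sum>a<k. \<epsilon> N * c N (add_mset (Suc a) (add_mset (k - a) (mset_on \<kappa> S)))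
           + (\<Sum>I\<in>Pow S. c N (add_mset (Suc a) (mset_on \<kappa> I)) * c N (add_mset (k - a) (mset_on \<kappa> (S - I)))))
       + 2 * (\<Sum>j\<in>S. real (\<kappa> j) * c N (add_mset (\<kappa> j + k + 1) (mset_on \<kappa> (S - {j :: nat}))))"
  assumes "A \<noteq> {#}"
  shows "\<exists>n::nat. (\<lambda>N. c N A) \<longlonglongrightarrow> real n"
  using assms(5)
proof (induction "sum_mset A" arbitrary: A rule: less_induct)
  case less
  define d where "d = sum_mset A"
  define L where "L B = (SOME n. (\<lambda>N. c N B) \<longlonglongrightarrow> real n)" for B
  have L: "(\<lambda>N. c N B) \<longlonglongrightarrow> real (L B)" if "B \<noteq> {#}" "sum_mset B < d" for B
    unfolding L_def by (rule someI_ex) (use less that d_def in auto)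
  have zero': "\<exists>n::nat. (\<lambda>N. c N B) \<longlonglongrightarrow> real n" if "0 \<in># B" for B
    using zero[of "B - {#0#}"] that
    by (intro exI[of _ "if B - {#0#} = {#} then 1 else 0"]) (auto split: if_splits)
  show ?case
  proof (cases "0 \<in># A")
    case True
    then show ?thesis by (rule zero')
  next
    case False
    define F where "F = {A :: nat multiset. 0 \<notin># A \<and> sum_mset A = d}"
    have finF: "finite F" unfolding F_def by (rule finite_positive_mset_sum)
    define M where "M N = (\<Sum>A\<in>F. \<bar>c N A\<bar>)" for N
    have M0: "M N \<ge> 0" for N by (simp add: M_def sum_nonneg)
    have cM: "\<bar>c N A\<bar> \<le> M N" if "A \<in> F" for A N
      unfolding M_def by (rule member_le_sum[OF that]) (auto simp: finF)
    define small where "small f \<longleftrightarrow> (\<lambda>N. f N / (1 + M N)) \<longlonglongrightarrow> 0" for f :: "nat \<Rightarrow> real"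
    have small_tendsto: "small f" if "f \<longlonglongrightarrow> 0" for f
    proof -
      have "\<bar>f N / (1 + M N)\<bar> \<le> \<bar>f N\<bar>" for N
        using M0[of N] by (simp add: abs_divide divide_le_eq mult_le_cancel_left1)
      then show ?thesis
        unfolding small_def real_norm_def[symmetric]
        by (intro Lim_null_comparison[OF _ tendsto_rabs_zero[OF that]] always_eventually allI) simp
    qed
    have small_add: "small (\<lambda>N. f N + g N)" if "small f" "small g" for f g
      using tendsto_add[OF that[unfolded small_def]] by (simp add: small_def add_divide_distrib)
    have small_mult: "small (\<lambda>N. a * f N)" if "small f" for f a
      using tendsto_mult_left[OF that[unfolded small_def], of a] by (simp add: small_def)
    have small_sum: "small (\<lambda>N. \<Sum>x\<in>X. f x N)" if "\<And>x. x \<in> X \<Longrightarrow> small (f x)"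
      for X :: "'x set" and f
      using tendsto_sum[of X "\<lambda>x N. f x N / (1 + M N)" "\<lambda>_. 0"] that
      by (simp add: small_def sum_divide_distrib)
    \<comment> \<open>An unknown of degree d is at most M in modulus, so a vanishing coefficient
      makes it negligible even while M might be unbounded.\<close>
    have small_prod: "small (\<lambda>N. e N * c N B)" if "e \<longlonglongrightarrow> 0" "B \<in> F" for e B
    proof -
      have "\<bar>e N * c N B / (1 + M N)\<bar> \<le> \<bar>e N\<bar>" for N
      proof -
        have "\<bar>c N B\<bar> \<le> 1 + M N" using cM[OF that(2), of N] by simp
        then have "\<bar>e N\<bar> * \<bar>c N B\<bar> \<le> \<bar>e N\<bar> * (1 + M N)" by (rule mult_left_mono) simp
        then show ?thesis using M0[of N] by (simp add: abs_divide abs_mult divide_le_eq)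
      qed
      then show ?thesis
        unfolding small_def real_norm_def[symmetric]
        by (intro Lim_null_comparison[OF _ tendsto_rabs_zero[OF that(1)]] always_eventually allI) simp
    qed
    \<comment> \<open>A second induction, on the number of entries, runs inside the fixed degree d:
      the derivative terms keep the degree and have one entry less.\<close>
    have ex_small: "\<exists>n::nat. small (\<lambda>N. c N B - real n)" if "B \<in> F" "B \<noteq> {#}" for B
      using that
    proof (induction "size B" arbitrary: B rule: less_induct)
      case (less B)
      define K where "K X = (SOME n. small (\<lambda>N. c N X - real n))" for X
      have K: "small (\<lambda>N. c N X - real (K X))" if "X \<in> F" "X \<noteq> {#}" "size X < size B" for X
        unfolding K_def by (rule someI_ex) (use less.hyps that in auto)
      obtain b B' where "B = add_mset b B'" using less.prems by (metis multiset_cases)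
      moreover have "b \<noteq> 0" using calculation less.prems by (auto simp: F_def)
      ultimately obtain k where B: "B = add_mset (Suc k) B'" by (metis not0_implies_Suc)
      obtain xs where xs: "B' = mset xs" by (metis ex_mset)
      define \<kappa> where "\<kappa> = (\<lambda>i. xs ! i)"
      define S where "S = {..<length xs}"
      have B': "B' = mset_on \<kappa> S" by (simp add: xs S_def \<kappa>_def mset_on_nth)
      have finS: "finite S" by (simp add: S_def)
      have d: "d = Suc k + sum \<kappa> S" using less.prems B B' by (auto simp: F_def sum_mset_mset_on)
      have pos: "\<kappa> i \<noteq> 0" if "i \<in> S" for i
        using less.prems that finS set_mset_mset_on[of S \<kappa>] by (force simp: F_def B B')
      have subsum: "sum \<kappa> I \<le> sum \<kappa> S" if "I \<subseteq> S" for I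
        by (rule sum_mono2) (use that finS in auto)
      have subpos: "0 \<notin># mset_on \<kappa> I" if "I \<subseteq> S" for I
        using that pos set_mset_mset_on[of I \<kappa>] finite_subset[OF that finS] by force
      \<comment> \<open>The limiting recursion evaluated in the natural numbers: \<open>L\<close>
        gives the limits of lower degree, \<open>K\<close> the centres already found in degree d
        with fewer entries.\<close>
      define n where "n = L (add_mset k B')
         + (\<Sum>a<k. \<Sum>I\<in>Pow S. L (add_mset (Suc a) (mset_on \<kappa> I)) * L (add_mset (k - a) (mset_on \<kappa> (S - I))))
         + 2 * (\<Sum>j\<in>S. \<kappa> j * K (add_mset (\<kappa> j + k + 1) (mset_on \<kappa> (S - {j}))))"
      \<comment> \<open>The difference between the finite-N and the limiting recursion; its first
        term comes from replacing \<open>r k N\<close> by 1 on the left side.\<close>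
      define err where "err N = (1 - r k N) * c N B + (c N (add_mset k B') - real (L (add_mset k B')))
         + (\<Sum>a<k. \<epsilon> N * c N (add_mset (Suc a) (add_mset (k - a) B'))
            + (\<Sum>I\<in>Pow S. c N (add_mset (Suc a) (mset_on \<kappa> I)) * c N (add_mset (k - a) (mset_on \<kappa> (S - I)))
                - real (L (add_mset (Suc a) (mset_on \<kappa> I)) * L (add_mset (k - a) (mset_on \<kappa> (S - I))))))
         + 2 * (\<Sum>j\<in>S. real (\<kappa> j) * (c N (add_mset (\<kappa> j + k + 1) (mset_on \<kappa> (S - {j})))
                - real (K (add_mset (\<kappa> j + k + 1) (mset_on \<kappa> (S - {j}))))))" for N
      have "small err" unfolding err_def
      proof (intro small_add small_sum small_mult)
        show "small (\<lambda>N. (1 - r k N) * c N B)"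
          using tendsto_diff[OF tendsto_const r[of k], of 1] less.prems by (intro small_prod) auto
        show "small (\<lambda>N. c N (add_mset k B') - real (L (add_mset k B')))"
          using L[of "add_mset k B'"] d by (intro small_tendsto) (auto simp: B' sum_mset_mset_on LIM_zero)
        show "small (\<lambda>N. \<epsilon> N * c N (add_mset (Suc a) (add_mset (k - a) B')))" if "a \<in> {..<k}" for a
          using that d subpos[of S] by (intro small_prod eps) (auto simp: F_def B' sum_mset_mset_on)
        show "small (\<lambda>N. c N (add_mset (Suc a) (mset_on \<kappa> I)) * c N (add_mset (k - a) (mset_on \<kappa> (S - I)))
                - real (L (add_mset (Suc a) (mset_on \<kappa> I)) * L (add_mset (k - a) (mset_on \<kappa> (S - I)))))"
          if "a \<in> {..<k}" "I \<in> Pow S" for a I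
        proof -
          \<comment> \<open>Both factors have lower degree: \<open>Suc a\<close> and
            \<open>k - a\<close> are at most k, whereas d = Suc k + sum \<kappa> S.\<close>
          have "sum_mset (add_mset (Suc a) (mset_on \<kappa> I)) < d"
            "sum_mset (add_mset (k - a) (mset_on \<kappa> (S - I))) < d"
            using that subsum[of I] subsum[of "S - I"] d by (auto simp: sum_mset_mset_on)
          then show ?thesis
            unfolding of_nat_mult by (intro small_tendsto LIM_zero tendsto_mult L) auto
        qed
        show "small (\<lambda>N. c N (add_mset (\<kappa> j + k + 1) (mset_on \<kappa> (S - {j})))
                - real (K (add_mset (\<kappa> j + k + 1) (mset_on \<kappa> (S - {j})))))" if "j \<in> S" for j
        proof (rule K)
          have "sum \<kappa> S = \<kappa> j + sum \<kappa> (S - {j})" using finS that by (rule sum.remove)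
          then show "add_mset (\<kappa> j + k + 1) (mset_on \<kappa> (S - {j})) \<in> F"
            using subpos[of "S - {j}"] d by (auto simp: F_def sum_mset_mset_on)
          show "size (add_mset (\<kappa> j + k + 1) (mset_on \<kappa> (S - {j}))) < size B"
            using that finS card_gt_0_iff[of S] by (auto simp: B B' size_mset_on)
        qed simp
      qed
      moreover have "\<forall>\<^sub>F N in sequentially. c N B - real n = err N"
        using loop[OF finS, of k \<kappa>]
      proof eventually_elim
        case (elim N)
        have "c N B - real n = (1 - r k N) * c N B + r k N * c N B - real n" by (simp add: algebra_simps)
        also have "\<dots> = err N"
          unfolding B B' elim unfolding err_def n_def B B'
          by (simp add: sum.distrib sum_subtractf algebra_simps)
        finally show ?case .
      qed
      then have "\<forall>\<^sub>F N in sequentially. err N / (1 + M N) = (c N B - real n) / (1 + M N)"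
        by eventually_elim simp
      ultimately have "small (\<lambda>N. c N B - real n)"
        unfolding small_def by (rule Lim_transform_eventually)
      then show ?case by blast
    qed
    define K where "K X = (SOME n. small (\<lambda>N. c N X - real n))" for X
    have AF: "A \<in> F" using False by (simp add: F_def d_def)
    \<comment> \<open>In degree 0 the family F would contain the empty multiset, which
      \<open>ex_small\<close> does not cover.\<close>
    have "d \<noteq> 0" using False less.prems by (auto simp: d_def dest: multi_nonempty_split)
    then have F_ne: "X \<noteq> {#}" if "X \<in> F" for X using that by (auto simp: F_def)
    have K: "small (\<lambda>N. c N X - real (K X))" if "X \<in> F" for X
      unfolding K_def by (rule someI_ex, rule ex_small) (use that F_ne in auto)
    define q where "q N = (\<Sum>X\<in>F. \<bar>c N X - real (K X)\<bar>) / (1 + M N)" for N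
    have q: "q \<longlonglongrightarrow> 0"
    proof -
      have "(\<lambda>N. \<Sum>X\<in>F. \<bar>(c N X - real (K X)) / (1 + M N)\<bar>) \<longlonglongrightarrow> (\<Sum>X\<in>F. 0)"
        by (intro tendsto_sum tendsto_rabs_zero) (use K in \<open>auto simp: small_def\<close>)
      moreover have "(\<Sum>X\<in>F. \<bar>(c N X - real (K X)) / (1 + M N)\<bar>) = q N" for N
        using M0[of N] by (simp add: q_def abs_divide sum_divide_distrib)
      ultimately show ?thesis by (simp add: fun_eq_iff)
    qed
    define C where "C = (\<Sum>X\<in>F. real (K X))"
    \<comment> \<open>Below 1/2 the relative error can be absorbed: M \<le> C + q (1 + M) then gives
      1 + M \<le> 2 C + 2, a bound free of N.\<close>
    have "\<forall>\<^sub>F N in sequentially. q N < 1 / 2"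
      using q by (rule order_tendstoD) simp
    then have "\<forall>\<^sub>F N in sequentially. norm (c N A - real (K A)) \<le> q N * (2 * C + 2)"
    proof eventually_elim
      case (elim N)
      have sum_eq: "(\<Sum>X\<in>F. \<bar>c N X - real (K X)\<bar>) = q N * (1 + M N)"
        using M0[of N] by (simp add: q_def)
      have "M N \<le> (\<Sum>X\<in>F. real (K X) + \<bar>c N X - real (K X)\<bar>)"
        unfolding M_def by (rule sum_mono) linarith
      also have "\<dots> = C + q N * (1 + M N)" by (simp add: sum.distrib C_def sum_eq)
      also have "\<dots> \<le> C + 1 / 2 * (1 + M N)"
        using elim M0[of N] by (intro add_left_mono mult_right_mono) auto
      finally have "1 + M N \<le> 2 * C + 2" by (simp add: field_simps)
      moreover have "q N \<ge> 0" using M0[of N] by (simp add: q_def sum_nonneg)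
      ultimately have "q N * (1 + M N) \<le> q N * (2 * C + 2)" by (rule mult_left_mono)
      moreover have "\<bar>c N A - real (K A)\<bar> \<le> (\<Sum>X\<in>F. \<bar>c N X - real (K X)\<bar>)"
        by (rule member_le_sum) (use AF finF in auto)
      ultimately show ?case using sum_eq by simp
    qed
    moreover have "(\<lambda>N. q N * (2 * C + 2)) \<longlonglongrightarrow> 0"
      using tendsto_mult_right[OF q, of "2 * C + 2"] by simp
    ultimately have "(\<lambda>N. c N A - real (K A)) \<longlonglongrightarrow> 0" by (rule Lim_null_comparison)
    then show ?thesis by (auto intro: LIM_zero_cancel)
  qed
qed

section \<open>Integrability of inverse power sums\<close>

text \<open>The fundamental theorem is applied on [1/(n+1), n+1], followed by dominated convergence.
  In the application E contains the positions of the other variables, where |x_i - x_j|^\<beta> is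
  continuous but need not be differentiable, as for \<beta> = 1.\<close>

lemma integral_derivative_half_line_eq_0:
  fixes f f' :: "real \<Rightarrow> real"
  assumes fin: "finite E"
    and deriv: "\<And>y. y > 0 \<Longrightarrow> y \<notin> E \<Longrightarrow> (f has_real_derivative f' y) (at y)"
    and cont: "continuous_on {0<..} f"
    and neg: "\<And>y. y \<le> 0 \<Longrightarrow> f' y = 0"
    and int: "integrable lborel f'"
    and lim0: "(f \<longlongrightarrow> 0) (at_right 0)" and lim_top: "(f \<longlongrightarrow> 0) at_top"
  shows "(\<integral>y. f' y \<partial>lborel) = 0"
proof -
  define l where "l n = inverse (real (Suc n))" for n
  define u where "u n = real (Suc n)" for n
  have l0: "l n > 0" for n by (simp add: l_def)
  have lu: "l n \<le> u n" for n
  proof -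
    have "l n \<le> 1" by (simp add: l_def inverse_le_1_iff)
    also have "1 \<le> u n" by (simp add: u_def)
    finally show ?thesis .
  qed
  have I: "(\<integral>y. indicator {l n..u n} y * f' y \<partial>lborel) = f (u n) - f (l n)" for n
  proof -
    have "(f' has_integral (f (u n) - f (l n))) {l n..u n}"
    proof (rule fundamental_theorem_of_calculus_strong[OF fin lu])
      show "continuous_on {l n..u n} f"
        using l0[of n] by (intro continuous_on_subset[OF cont]) auto
      show "(f has_vector_derivative f' x) (at x)" if "x \<in> {l n..u n} - E" for x
        using deriv[of x] l0[of n] that
        by (auto simp flip: has_real_derivative_iff_has_vector_derivative intro!: has_field_derivative_at_within)
    qed
    moreover have "set_integrable lborel {l n..u n} f'"
      unfolding set_integrable_def using int by (intro integrable_mult_indicator) auto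
    ultimately show ?thesis
      using set_borel_integral_eq_integral(2)[of "{l n..u n}" f']
      by (simp add: set_lebesgue_integral_def integral_unique)
  qed
  have lim1: "(\<lambda>n. \<integral>y. indicator {l n..u n} y * f' y \<partial>lborel) \<longlonglongrightarrow> (\<integral>y. f' y \<partial>lborel)"
  proof (rule integral_dominated_convergence[where w = "\<lambda>y. norm (f' y)"])
    show "integrable lborel (\<lambda>y. norm (f' y))" using int by (rule integrable_norm)
    show "AE y in lborel. (\<lambda>n. indicator {l n..u n} y * f' y) \<longlonglongrightarrow> f' y"
    proof (rule AE_I2)
      fix y :: real
      show "(\<lambda>n. indicator {l n..u n} y * f' y) \<longlonglongrightarrow> f' y"
      proof (cases "y > 0")
        case False
        then show ?thesis using neg by simp
      next
        case True
        have "\<forall>\<^sub>F n in sequentially. l n < y"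
          unfolding l_def using order_tendstoD(2)[OF LIMSEQ_inverse_real_of_nat True] .
        moreover have "\<forall>\<^sub>F n in sequentially. y \<le> u n"
          unfolding u_def using eventually_ge_at_top[of "nat \<lceil>y\<rceil>"]
          by eventually_elim linarith
        ultimately have "\<forall>\<^sub>F n in sequentially. f' y = indicator {l n..u n} y * f' y"
          by eventually_elim auto
        then show ?thesis by (rule Lim_transform_eventually[OF tendsto_const])
      qed
    qed
    show "AE y in lborel. norm (indicator {l n..u n} y * f' y) \<le> norm (f' y)" for n
      by (intro AE_I2) (auto simp: indicator_def)
  qed (use int in auto)
  have lim2: "(\<lambda>n. f (u n) - f (l n)) \<longlonglongrightarrow> 0 - 0"
  proof (rule tendsto_diff)
    have "filterlim u at_top sequentially"
      unfolding u_def by (rule filterlim_compose[OF filterlim_real_sequentially filterlim_Suc])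
    then show "(\<lambda>n. f (u n)) \<longlonglongrightarrow> 0" by (rule filterlim_compose[OF lim_top])
    have "filterlim l (at_right 0) sequentially"
      unfolding filterlim_at using LIMSEQ_inverse_real_of_nat l0 by (simp add: l_def[abs_def])
    then show "(\<lambda>n. f (l n)) \<longlonglongrightarrow> 0" by (rule filterlim_compose[OF lim0])
  qed
  show ?thesis using LIMSEQ_unique[OF lim1[unfolded I] lim2] by simp
qed

section \<open>One-variable majorants\<close>

lemma power_le_exp_bound:
  fixes \<delta> :: real
  assumes "\<delta> > 0"
  shows "\<exists>K\<ge>0. \<forall>y\<ge>0. (1 + y) ^ m \<le> K * exp (\<delta> * y)"
proof -
  have "(1 + y) ^ m \<le> fact m / \<delta> ^ m * exp \<delta> * exp (\<delta> * y)" if "y \<ge> 0" for y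
  proof -
    let ?t = "\<delta> * (1 + y)"
    have t: "?t \<ge> 0" using assms that by simp
    \<comment> \<open>A single term of the exponential series, t^m / m! \<le> e^t at t = \<delta> (1
      + y), yields the constant m! e^\<delta> / \<delta>^m.\<close>
    have "(\<Sum>n<Suc m. ?t ^ n / fact n) \<le> exp ?t"
      unfolding exp_def scaleR_conv_of_real
      using sum_le_suminf[OF summable_exp_generic[of ?t], of "{..<Suc m}"] t
      by (simp add: divide_inverse mult.commute)
    moreover have "?t ^ m / fact m \<le> (\<Sum>n<Suc m. ?t ^ n / fact n)"
      using t by (intro member_le_sum) auto
    ultimately have "?t ^ m / fact m \<le> exp (\<delta> + \<delta> * y)" by (simp add: algebra_simps)
    then have "\<delta> ^ m * (1 + y) ^ m \<le> fact m * (exp \<delta> * exp (\<delta> * y))"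
      by (simp add: exp_add power_mult_distrib pos_divide_le_eq mult.commute)
    then show ?thesis using assms by (simp add: field_simps)
  qed
  then show ?thesis using assms by (intro exI[of _ "fact m / \<delta> ^ m * exp \<delta>"]) auto
qed

text \<open>The factor y makes the majorant vanish at 0, which removes the boundary term there; the
  exponential beats the polynomial at infinity. The value 0 for y \<le> 0 matches the density
  outside the orthant, so that products over the coordinates can bound it everywhere.\<close>

definition laguerre_bound :: "nat \<Rightarrow> real \<Rightarrow> real \<Rightarrow> real" where
  "laguerre_bound M c y = (if y > 0 then y * (1 + y) ^ M * exp (- c * y) else 0)"

lemma laguerre_bound_nonneg: "laguerre_bound M c y \<ge> 0"
  by (simp add: laguerre_bound_def)

text \<open>Half of the decay rate is spent on the polynomial factor.\<close>

lemma laguerre_bound_le_exp: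
  assumes "c > 0"
  shows "\<exists>K\<ge>0. \<forall>y\<ge>0. laguerre_bound M c y \<le> K * exp (- (c / 2) * y)"
proof -
  obtain K where K: "K \<ge> 0" "\<And>y. y \<ge> 0 \<Longrightarrow> (1 + y) ^ Suc M \<le> K * exp (c / 2 * y)"
    using power_le_exp_bound[of "c / 2" "Suc M"] assms by auto
  have "laguerre_bound M c y \<le> K * exp (- (c / 2) * y)" if "y \<ge> 0" for y
  proof -
    have "laguerre_bound M c y \<le> (1 + y) ^ Suc M * exp (- c * y)"
      using that by (auto simp: laguerre_bound_def intro!: mult_right_mono)
    also have "\<dots> \<le> K * exp (c / 2 * y) * exp (- c * y)"
      using K(2)[OF that] by (intro mult_right_mono) auto
    also have "\<dots> = K * exp (- (c / 2) * y)"
      by (simp add: mult.assoc flip: exp_add)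
    finally show ?thesis .
  qed
  then show ?thesis using K(1) by blast
qed

lemma laguerre_bound_at_top:
  assumes "c > 0"
  shows "(laguerre_bound M c \<longlongrightarrow> 0) at_top"
proof -
  obtain K where K: "K \<ge> 0" "\<forall>y\<ge>0. laguerre_bound M c y \<le> K * exp (- (c / 2) * y)"
    using laguerre_bound_le_exp[OF assms] by blast
  have "filterlim (\<lambda>y. - (c / 2) * y) at_bot at_top"
    using assms by (intro filterlim_tendsto_neg_mult_at_bot[OF tendsto_const]) (auto simp: filterlim_ident)
  then have "((\<lambda>y. exp (- (c / 2) * y)) \<longlongrightarrow> 0) at_top"
    by (rule filterlim_compose[OF exp_at_bot])
  then have "((\<lambda>y. K * exp (- (c / 2) * y)) \<longlongrightarrow> 0) at_top"
    by (rule tendsto_mult_right_zero)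
  moreover have "\<forall>\<^sub>F y in at_top. norm (laguerre_bound M c y) \<le> K * exp (- (c / 2) * y)"
    using eventually_ge_at_top[of 0] by eventually_elim (use K(2) laguerre_bound_nonneg[of M c] in simp)
  ultimately show ?thesis by (rule Lim_null_comparison[rotated])
qed

lemma laguerre_bound_at_right_0: "(laguerre_bound M c \<longlongrightarrow> 0) (at_right 0)"
proof -
  have "((\<lambda>y. y * (1 + y) ^ M * exp (- c * y)) \<longlongrightarrow> 0 * (1 + 0) ^ M * exp (- c * 0)) (at_right 0)"
    by (intro tendsto_intros)
  then have "((\<lambda>y. y * (1 + y) ^ M * exp (- c * y)) \<longlongrightarrow> 0) (at_right 0)" by simp
  then show ?thesis
    by (rule Lim_transform_eventually)
      (use eventually_at_right_less[of 0] in \<open>eventually_elim, simp add: laguerre_bound_def\<close>)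
qed

lemma borel_measurable_laguerre_bound [measurable]: "laguerre_bound M c \<in> borel_measurable borel"
  unfolding laguerre_bound_def by measurable

lemma integrable_laguerre_bound:
  assumes "c > 0"
  shows "integrable lborel (laguerre_bound M c)"
proof -
  obtain K where K: "K \<ge> 0" "\<forall>y\<ge>0. laguerre_bound M c y \<le> K * exp (- (c / 2) * y)"
    using laguerre_bound_le_exp[OF assms] by blast
  have "(\<lambda>y. exp (- (c / 2) * y)) absolutely_integrable_on {0..}"
    using assms by (intro nonnegative_absolutely_integrable_1 integrable_on_exp_minus_to_infinity) auto
  then have "integrable lborel (\<lambda>y. indicator {0..} y * exp (- (c / 2) * y))"
    unfolding set_integrable_def by (simp add: integrable_completion)
  then have "integrable lborel (\<lambda>y. K * (indicator {0..} y * exp (- (c / 2) * y)))"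
    by (rule integrable_mult_right)
  then show ?thesis
  proof (rule Bochner_Integration.integrable_bound)
    show "AE y in lborel. norm (laguerre_bound M c y) \<le> norm (K * (indicator {0..} y * exp (- (c / 2) * y)))"
    proof (rule AE_I2)
      fix y show "norm (laguerre_bound M c y) \<le> norm (K * (indicator {0..} y * exp (- (c / 2) * y)))"
        using K laguerre_bound_nonneg[of M c y]
        by (cases "y \<ge> 0") (auto simp: laguerre_bound_def)
    qed
  qed simp
qed

section \<open>Majorants of the joint density\<close>

lemma ws_space_sigma: "product_sigma_finite (\<lambda>_::nat. lborel :: real measure)"
  by standard

lemma measurable_ws_component:
  "i < N \<Longrightarrow> (\<lambda>x. x i) \<in> borel_measurable (ws_space N)"
  using measurable_component_singleton[of i "{..<N}" "\<lambda>_. lborel :: real measure"]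
  by (simp add: ws_space_def)

lemma measurable_ws_weight: "ws_weight \<beta> N \<in> borel_measurable (ws_space N)"
  unfolding ws_weight_def[abs_def]
proof (rule measurable_If)
  show "{x \<in> space (ws_space N). \<forall>k<N. 0 < x k} \<in> sets (ws_space N)"
  proof -
    have "{x \<in> space (ws_space N). \<forall>k\<in>{..<N}. 0 < x k} \<in> sets (ws_space N)"
      by (intro sets.sets_Collect_finite_All borel_measurable_less borel_measurable_const
          measurable_ws_component) auto
    then show ?thesis by (simp only: Ball_def lessThan_iff)
  qed
next
  have comp: "(\<lambda>x. x i) \<in> borel_measurable (ws_space N)" if "i < N" for i
    using that by (rule measurable_ws_component)
  have "(\<lambda>x. \<bar>x i - x j\<bar> powr \<beta>) \<in> borel_measurable (ws_space N)" if "i < N" "j < N" for i j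
    using comp[OF that(1)] comp[OF that(2)] by measurable
  moreover have "(\<lambda>x. x k powr (\<beta> * real N / 2) * exp (- \<beta> * real N * x k / 2)) \<in> borel_measurable (ws_space N)"
    if "k < N" for k
    using comp[OF that] by measurable
  ultimately show "(\<lambda>x. (\<Prod>i<N. \<Prod>j\<in>{i<..<N}. \<bar>x i - x j\<bar> powr \<beta>) *
      (\<Prod>k<N. x k powr (\<beta> * real N / 2) * exp (- \<beta> * real N * x k / 2))) \<in> borel_measurable (ws_space N)"
    by (intro borel_measurable_times[OF borel_measurable_prod borel_measurable_prod] borel_measurable_prod) auto
qed simp

text \<open>A bound of product form, so that the majorant of the Vandermonde factor splits over the
  coordinates and integrability reduces to one variable.\<close>

lemma abs_diff_le_prod:
  fixes x :: "nat \<Rightarrow> real"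
  assumes "\<forall>k<N. x k > 0" "i < N" "j < N"
  shows "\<bar>x i - x j\<bar> \<le> (\<Prod>k<N. 1 + x k)"
proof -
  have le: "1 + x l \<le> (\<Prod>k<N. 1 + x k)" if "l < N" for l
  proof -
    have "(\<Prod>k\<in>{l}. 1 + x k) \<le> (\<Prod>k<N. 1 + x k)"
      using assms that by (intro prod_mono2) (auto intro: less_imp_le)
    then show ?thesis by simp
  qed
  have "\<bar>x i - x j\<bar> \<le> max (x i) (x j)" using assms by (auto simp: abs_if max_def)
  also have "\<dots> \<le> (\<Prod>k<N. 1 + x k)" using le[of i] le[of j] assms by auto
  finally show ?thesis .
qed

lemma powr_le_power_ceiling:
  fixes t P :: real
  assumes "0 \<le> t" "t \<le> P" "1 \<le> P" "0 \<le> a" "a \<le> b"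
  shows "t powr a \<le> P ^ nat \<lceil>b\<rceil>"
proof -
  have "t powr a \<le> P powr a" using assms by (intro powr_mono2) auto
  also have "\<dots> \<le> P powr real (nat \<lceil>b\<rceil>)" using assms by (intro powr_mono) linarith+
  also have "\<dots> = P ^ nat \<lceil>b\<rceil>" by (rule powr_realpow) (use assms in linarith)
  finally show ?thesis .
qed

lemma abs_pair_prod_le:
  fixes g :: "nat \<Rightarrow> nat \<Rightarrow> real"
  assumes "1 \<le> Q" and g: "\<And>i j. i < N \<Longrightarrow> j < N \<Longrightarrow> \<bar>g i j\<bar> \<le> Q"
  shows "\<bar>\<Prod>i<N. \<Prod>j\<in>{i<..<N}. g i j\<bar> \<le> Q ^ (N * N)"
proof -
  have "\<bar>\<Prod>i<N. \<Prod>j\<in>{i<..<N}. g i j\<bar> = (\<Prod>i<N. \<Prod>j\<in>{i<..<N}. \<bar>g i j\<bar>)"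
    by (simp add: abs_prod)
  also have "\<dots> \<le> (\<Prod>i<N. Q ^ N)"
  proof (rule prod_mono, rule conjI)
    fix i assume i: "i \<in> {..<N}"
    have "(\<Prod>j\<in>{i<..<N}. \<bar>g i j\<bar>) \<le> (\<Prod>j\<in>{i<..<N}. Q)"
      using g i by (intro prod_mono) auto
    also have "\<dots> \<le> Q ^ N" using assms(1) by (simp add: power_increasing)
    finally show "(\<Prod>j\<in>{i<..<N}. \<bar>g i j\<bar>) \<le> Q ^ N" .
  qed (auto intro: prod_nonneg)
  also have "\<dots> = Q ^ (N * N)" by (simp add: power_mult)
  finally show ?thesis .
qed

abbreviation vandermonde_power :: "real \<Rightarrow> nat \<Rightarrow> (nat \<Rightarrow> real) \<Rightarrow> real" where
  "vandermonde_power \<beta> N x \<equiv> (\<Prod>i<N. \<Prod>j\<in>{i<..<N}. \<bar>x i - x j\<bar> powr \<beta>)"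

lemma vandermonde_power_le:
  assumes "\<beta> \<ge> 1" "\<forall>k<N. x k > 0"
  shows "\<bar>vandermonde_power \<beta> N x\<bar> \<le> (\<Prod>k<N. 1 + x k) ^ (nat \<lceil>\<beta>\<rceil> * (N * N))"
proof -
  have P1: "1 \<le> (\<Prod>k<N. 1 + x k)" using assms(2) by (intro prod_ge_1) (auto intro: less_imp_le)
  show ?thesis unfolding power_mult[of _ "nat \<lceil>\<beta>\<rceil>"]
    using assms P1 abs_diff_le_prod[OF assms(2)]
    by (intro abs_pair_prod_le) (auto intro!: powr_le_power_ceiling one_le_power)
qed

lemma vandermonde_power_divide_le:
  assumes "\<beta> \<ge> 1" "\<forall>k<N. x k > 0" "a < b" "b < N"
  shows "\<bar>vandermonde_power \<beta> N x / (x a - x b)\<bar> \<le> (\<Prod>k<N. 1 + x k) ^ (nat \<lceil>\<beta>\<rceil> * (N * N))"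
proof -
  have P1: "1 \<le> (\<Prod>k<N. 1 + x k)" using assms(2) by (intro prod_ge_1) (auto intro: less_imp_le)
  define t where "t = x a - x b"
  \<comment> \<open>\<open>h\<close> assigns the division to the single factor of the pair (a, b),
    leaving there |t|^(\<beta> - 1) in modulus. If t = 0 the quotient is 0 by convention and falls
    under the other case below.\<close>
  define h where "h i j = (if i = a \<and> j = b then 1 / t else 1)" for i j
  have "(\<Prod>j\<in>{i<..<N}. h i j) = (if i = a then 1 / t else 1)" if "i < N" for i
    using assms by (cases "i = a") (auto simp: h_def)
  then have "(\<Prod>i<N. \<Prod>j\<in>{i<..<N}. h i j) = (\<Prod>i<N. if i = a then 1 / t else 1)"
    by (intro prod.cong) auto
  also have "\<dots> = 1 / t" using assms by simp
  finally have h: "(\<Prod>i<N. \<Prod>j\<in>{i<..<N}. h i j) = 1 / t" .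
  have eq: "vandermonde_power \<beta> N x / t = (\<Prod>i<N. \<Prod>j\<in>{i<..<N}. \<bar>x i - x j\<bar> powr \<beta> * h i j)"
    by (simp add: prod.distrib h)
  have bound: "\<bar>\<bar>x i - x j\<bar> powr \<beta> * h i j\<bar> \<le> (\<Prod>k<N. 1 + x k) ^ nat \<lceil>\<beta>\<rceil>" if "i < N" "j < N" for i j
  proof (cases "i = a \<and> j = b \<and> t \<noteq> 0")
    case True
    then have "\<bar>\<bar>x i - x j\<bar> powr \<beta> * h i j\<bar> = \<bar>t\<bar> powr (\<beta> - 1)"
      by (simp add: h_def t_def powr_diff abs_mult)
    also have "\<dots> \<le> (\<Prod>k<N. 1 + x k) ^ nat \<lceil>\<beta>\<rceil>"
      using assms P1 abs_diff_le_prod[OF assms(2), of a b] 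
      by (intro powr_le_power_ceiling) (auto simp: t_def)
    finally show ?thesis .
  next
    case False
    then have "\<bar>\<bar>x i - x j\<bar> powr \<beta> * h i j\<bar> \<le> \<bar>x i - x j\<bar> powr \<beta>"
      by (auto simp: h_def t_def)
    also have "\<dots> \<le> (\<Prod>k<N. 1 + x k) ^ nat \<lceil>\<beta>\<rceil>"
      using assms P1 abs_diff_le_prod[OF assms(2) that] by (intro powr_le_power_ceiling) auto
    finally show ?thesis .
  qed
  show ?thesis
    unfolding t_def[symmetric] eq power_mult[of _ "nat \<lceil>\<beta>\<rceil>"]
    by (rule abs_pair_prod_le) (use bound P1 in \<open>auto intro: one_le_power\<close>)
qed

text \<open>Of the power y^a, the part y^D turns (1 + 1/y)^D into (1 + y)^D, one factor y is kept to
  force decay at 0, and the rest has exponent a - D - 1 \<ge> 0 and hence polynomial growth. This is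
  the source of the condition D + 1 \<le> a.\<close>

lemma laguerre_weight_le:
  fixes a y :: real
  assumes "y > 0" "real D + 1 \<le> a"
  shows "(1 + 1 / y) ^ D * (1 + y) ^ Q * (y powr a * exp (- a * y)) \<le> laguerre_bound (Q + D + nat \<lceil>a\<rceil>) a y"
proof -
  have "y powr a = y ^ D * (y * y powr (a - D - 1))"
    using assms(1) by (simp add: powr_diff powr_realpow[symmetric])
  moreover have "(1 + 1 / y) ^ D * y ^ D = (1 + y) ^ D"
    using assms(1) by (simp add: power_mult_distrib[symmetric] field_simps)
  ultimately have "(1 + 1 / y) ^ D * y powr a = (1 + y) ^ D * y * y powr (a - D - 1)"
    by (metis (no_types, opaque_lifting) mult.assoc)
  also have "\<dots> \<le> (1 + y) ^ D * y * (1 + y) ^ nat \<lceil>a\<rceil>"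
    using assms by (intro mult_left_mono powr_le_power_ceiling) auto
  finally have "(1 + 1 / y) ^ D * y powr a * ((1 + y) ^ Q * exp (- a * y))
      \<le> (1 + y) ^ D * y * (1 + y) ^ nat \<lceil>a\<rceil> * ((1 + y) ^ Q * exp (- a * y))"
    using assms by (intro mult_right_mono) auto
  then show ?thesis using assms(1) by (simp add: laguerre_bound_def power_add mult_ac)
qed

text \<open>
  The factor v stands for the Vandermonde power, possibly divided by one of the differences;
  the latter is still bounded because of \<open>\<beta> \<ge> 1\<close>.
\<close>
lemma ws_density_le:
  fixes x :: "nat \<Rightarrow> real"
  assumes pos: "\<forall>k<N. x k > 0" and D: "real D + 1 \<le> a"
    and v: "\<bar>v\<bar> \<le> (\<Prod>k<N. 1 + x k) ^ Q"
  shows "(\<Prod>k<N. 1 + 1 / x k) ^ D * \<bar>v * (\<Prod>k<N. x k powr a * exp (- a * x k))\<bar>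
      \<le> (\<Prod>k<N. laguerre_bound (Q + D + nat \<lceil>a\<rceil>) a (x k))"
proof -
  have nn: "(\<Prod>k<N. x k powr a * exp (- a * x k)) \<ge> 0" by (intro prod_nonneg) auto
  have U: "(\<Prod>k<N. 1 + 1 / x k) ^ D \<ge> 0"
    using pos by (intro zero_le_power prod_nonneg) (auto intro: add_nonneg_nonneg less_imp_le)
  have "(\<Prod>k<N. 1 + 1 / x k) ^ D * \<bar>v * (\<Prod>k<N. x k powr a * exp (- a * x k))\<bar>
     \<le> (\<Prod>k<N. 1 + 1 / x k) ^ D * ((\<Prod>k<N. 1 + x k) ^ Q * (\<Prod>k<N. x k powr a * exp (- a * x k)))"
    unfolding abs_mult using nn U v by (intro mult_left_mono mult_mono) auto
  also have "\<dots> = (\<Prod>k<N. (1 + 1 / x k) ^ D * (1 + x k) ^ Q * (x k powr a * exp (- a * x k)))"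
    by (simp add: prod.distrib prod_power_distrib mult_ac)
  also have "\<dots> \<le> (\<Prod>k<N. laguerre_bound (Q + D + nat \<lceil>a\<rceil>) a (x k))"
    using pos D by (intro prod_mono conjI laguerre_weight_le)
      (auto intro!: mult_nonneg_nonneg zero_le_power add_nonneg_nonneg intro: less_imp_le)
  finally show ?thesis .
qed

text \<open>D bounds the order of the poles at the walls x_k = 0. It adds up under products, so the
  total degree of a product of inverse power sums can serve as D. The bound concerns the open
  orthant only, because the density vanishes off it.\<close>

definition dominated :: "nat \<Rightarrow> nat \<Rightarrow> ((nat \<Rightarrow> real) \<Rightarrow> real) \<Rightarrow> bool" where
  "dominated N D G \<longleftrightarrow> G \<in> borel_measurable (ws_space N) \<and>
     (\<exists>K\<ge>0. \<forall>x. (\<forall>k<N. x k > 0) \<longrightarrow> \<bar>G x\<bar> \<le> K * (\<Prod>k<N. 1 + 1 / x k) ^ D)"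

lemma prod_one_plus_inverse_ge_1:
  fixes x :: "nat \<Rightarrow> real"
  assumes "\<forall>k<N. x k > 0"
  shows "1 \<le> (\<Prod>k<N. 1 + 1 / x k)"
  using assms by (intro prod_ge_1) (auto intro: less_imp_le)

lemma dominated_mono:
  assumes G: "dominated N D G" and "D \<le> D'"
  shows "dominated N D' G"
proof -
  obtain K where K: "K \<ge> 0" "\<And>x. (\<forall>k<N. x k > 0) \<Longrightarrow> \<bar>G x\<bar> \<le> K * (\<Prod>k<N. 1 + 1 / x k) ^ D"
    using G unfolding dominated_def by blast
  have "\<bar>G x\<bar> \<le> K * (\<Prod>k<N. 1 + 1 / x k) ^ D'" if "\<forall>k<N. x k > 0" for x
  proof -
    have "K * (\<Prod>k<N. 1 + 1 / x k) ^ D \<le> K * (\<Prod>k<N. 1 + 1 / x k) ^ D'"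
      using prod_one_plus_inverse_ge_1[OF that] K(1) assms(2) by (intro mult_left_mono power_increasing) auto
    then show ?thesis using K(2)[OF that] by linarith
  qed
  then show ?thesis using G K(1) unfolding dominated_def by blast
qed

lemma dominated_mult:
  assumes "dominated N D1 G" "dominated N D2 H"
  shows "dominated N (D1 + D2) (\<lambda>x. G x * H x)"
proof -
  obtain K where K: "K \<ge> 0" "\<And>x. (\<forall>k<N. x k > 0) \<Longrightarrow> \<bar>G x\<bar> \<le> K * (\<Prod>k<N. 1 + 1 / x k) ^ D1"
    using assms(1) unfolding dominated_def by blast
  obtain L where L: "L \<ge> 0" "\<And>x. (\<forall>k<N. x k > 0) \<Longrightarrow> \<bar>H x\<bar> \<le> L * (\<Prod>k<N. 1 + 1 / x k) ^ D2"
    using assms(2) unfolding dominated_def by blast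
  have "\<bar>G x * H x\<bar> \<le> (K * L) * (\<Prod>k<N. 1 + 1 / x k) ^ (D1 + D2)" if "\<forall>k<N. x k > 0" for x
  proof -
    have "\<bar>G x * H x\<bar> \<le> (K * (\<Prod>k<N. 1 + 1 / x k) ^ D1) * (L * (\<Prod>k<N. 1 + 1 / x k) ^ D2)"
      unfolding abs_mult using K(1) L(1) prod_one_plus_inverse_ge_1[OF that]
      by (intro mult_mono K(2) L(2) that mult_nonneg_nonneg zero_le_power) auto
    then show ?thesis by (simp add: power_add mult_ac)
  qed
  then show ?thesis
    using assms K(1) L(1) unfolding dominated_def
    by (intro conjI borel_measurable_times exI[of _ "K * L"]) auto
qed

lemma dominated_const: "dominated N 0 (\<lambda>_. a)"
  unfolding dominated_def by (intro conjI exI[of _ "\<bar>a\<bar>"]) auto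

lemma dominated_add:
  assumes "dominated N D G" "dominated N D H"
  shows "dominated N D (\<lambda>x. G x + H x)"
proof -
  obtain K where K: "K \<ge> 0" "\<And>x. (\<forall>k<N. x k > 0) \<Longrightarrow> \<bar>G x\<bar> \<le> K * (\<Prod>k<N. 1 + 1 / x k) ^ D"
    using assms(1) unfolding dominated_def by blast
  obtain L where L: "L \<ge> 0" "\<And>x. (\<forall>k<N. x k > 0) \<Longrightarrow> \<bar>H x\<bar> \<le> L * (\<Prod>k<N. 1 + 1 / x k) ^ D"
    using assms(2) unfolding dominated_def by blast
  have "\<bar>G x + H x\<bar> \<le> (K + L) * (\<Prod>k<N. 1 + 1 / x k) ^ D" if "\<forall>k<N. x k > 0" for x
    using K(2)[OF that] L(2)[OF that] by (simp add: distrib_right)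
  then show ?thesis
    using assms K(1) L(1) unfolding dominated_def
    by (intro conjI borel_measurable_add exI[of _ "K + L"]) auto
qed

lemma dominated_sum:
  assumes "\<And>i. i \<in> I \<Longrightarrow> dominated N D (G i)"
  shows "dominated N D (\<lambda>x. \<Sum>i\<in>I. G i x)"
  using assms
proof (induction I rule: infinite_finite_induct)
  case (insert i I)
  then show ?case by (simp add: dominated_add)
qed (auto intro: dominated_mono[OF dominated_const])

lemma dominated_cmult: "dominated N D G \<Longrightarrow> dominated N D (\<lambda>x. a * G x)"
  using dominated_mult[OF dominated_const] by force

lemma dominated_inverse_power:
  assumes "i < N"
  shows "dominated N k (\<lambda>x. 1 / x i ^ k)"
proof -
  have "\<bar>1 / x i ^ k\<bar> \<le> 1 * (\<Prod>k<N. 1 + 1 / x k) ^ k" if pos: "\<forall>k<N. x k > 0" for x :: "nat \<Rightarrow> real"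
  proof -
    have "(\<Prod>k\<in>{i}. 1 + 1 / x k) \<le> (\<Prod>k<N. 1 + 1 / x k)"
      using pos assms by (intro prod_mono2) (auto intro: less_imp_le add_nonneg_nonneg)
    then have "1 / x i \<le> (\<Prod>k<N. 1 + 1 / x k)" by simp
    then have "(1 / x i) ^ k \<le> (\<Prod>k<N. 1 + 1 / x k) ^ k"
      using pos assms by (intro power_mono) (auto intro: less_imp_le)
    moreover have "\<bar>1 / x i ^ k\<bar> = (1 / x i) ^ k"
      using pos assms by (simp add: power_one_over power_abs abs_of_pos)
    ultimately show ?thesis by simp
  qed
  moreover have "(\<lambda>x. 1 / x i ^ k) \<in> borel_measurable (ws_space N)"
    using measurable_ws_component[OF assms] by measurable
  ultimately show ?thesis unfolding dominated_def by (intro conjI exI[of _ 1]) auto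
qed

lemma dominated_ws_T: "dominated N k (ws_T k N)"
  unfolding ws_T_def[abs_def]
  by (intro dominated_cmult dominated_sum dominated_inverse_power) auto

lemma ws_weight_on_orthant:
  assumes "\<forall>k<N. x k > 0"
  shows "ws_weight \<beta> N x = vandermonde_power \<beta> N x *
     (\<Prod>k<N. x k powr (\<beta> * real N / 2) * exp (- (\<beta> * real N / 2) * x k))"
  unfolding ws_weight_def if_P[OF assms] by simp

lemma ws_weight_off_orthant: "\<not> (\<forall>k<N. x k > 0) \<Longrightarrow> ws_weight \<beta> N x = 0"
  unfolding ws_weight_def by (rule if_not_P)

lemma ws_weight_nonneg: "ws_weight \<beta> N x \<ge> 0"
  unfolding ws_weight_def by (auto intro!: mult_nonneg_nonneg prod_nonneg)

text \<open>Quotients by a difference are what the drift produces. The plain bound also controls the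
  boundary terms of the integration by parts, which call for a pointwise estimate and not only for
  integrability.\<close>

lemma dominated_ws_weight_le:
  assumes "\<beta> \<ge> 1" "real D + 1 \<le> \<beta> * real N / 2" and G: "dominated N D G"
  shows "\<exists>K\<ge>0. \<exists>M. \<forall>x. \<bar>G x * ws_weight \<beta> N x\<bar> \<le> K * (\<Prod>k<N. laguerre_bound M (\<beta> * real N / 2) (x k))
     \<and> (\<forall>a b. a < b \<longrightarrow> b < N \<longrightarrow>
         \<bar>G x * (ws_weight \<beta> N x / (x a - x b))\<bar> \<le> K * (\<Prod>k<N. laguerre_bound M (\<beta> * real N / 2) (x k)))"
proof -
  obtain K where K: "K \<ge> 0" "\<And>x. (\<forall>k<N. x k > 0) \<Longrightarrow> \<bar>G x\<bar> \<le> K * (\<Prod>k<N. 1 + 1 / x k) ^ D"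
    using G unfolding dominated_def by blast
  define c where "c = \<beta> * real N / 2"
  define Q where "Q = nat \<lceil>\<beta>\<rceil> * (N * N)"
  define M where "M = Q + D + nat \<lceil>c\<rceil>"
  define B where "B x = (\<Prod>k<N. laguerre_bound M c (x k))" for x
  have B0: "B x \<ge> 0" for x unfolding B_def by (intro prod_nonneg) (simp add: laguerre_bound_nonneg)
  have main: "\<bar>G x * (v * (\<Prod>k<N. x k powr c * exp (- c * x k)))\<bar> \<le> K * B x"
    if pos: "\<forall>k<N. x k > 0" and v: "\<bar>v\<bar> \<le> (\<Prod>k<N. 1 + x k) ^ Q" for x v
  proof -
    have "\<bar>G x * (v * (\<Prod>k<N. x k powr c * exp (- c * x k)))\<bar>
        \<le> K * (\<Prod>k<N. 1 + 1 / x k) ^ D * \<bar>v * (\<Prod>k<N. x k powr c * exp (- c * x k))\<bar>"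
      unfolding abs_mult[of "G x"] by (intro mult_right_mono K(2) pos) auto
    also have "\<dots> \<le> K * B x"
      unfolding mult.assoc B_def M_def using assms(2) K(1)
      by (intro mult_left_mono ws_density_le pos v) (auto simp: c_def)
    finally show ?thesis .
  qed
  have "\<bar>G x * ws_weight \<beta> N x\<bar> \<le> K * B x \<and> (\<forall>a b. a < b \<longrightarrow> b < N \<longrightarrow>
         \<bar>G x * (ws_weight \<beta> N x / (x a - x b))\<bar> \<le> K * B x)" for x
  proof (cases "\<forall>k<N. x k > 0")
    case False
    then have "ws_weight \<beta> N x = 0" by (rule ws_weight_off_orthant)
    then show ?thesis using K(1) B0[of x] by simp
  next
    case True
    have w: "ws_weight \<beta> N x = vandermonde_power \<beta> N x * (\<Prod>k<N. x k powr c * exp (- c * x k))"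
      unfolding c_def by (rule ws_weight_on_orthant[OF True])
    have w': "ws_weight \<beta> N x / t = vandermonde_power \<beta> N x / t * (\<Prod>k<N. x k powr c * exp (- c * x k))" for t
      by (simp add: w)
    show ?thesis
      using main[OF True vandermonde_power_le[OF assms(1) True, folded Q_def]]
        main[OF True vandermonde_power_divide_le[OF assms(1) True, folded Q_def]]
      unfolding w' unfolding w by blast
  qed
  then show ?thesis using K(1) unfolding B_def c_def by blast
qed

lemma integrable_prod_laguerre_bound:
  assumes "c > 0"
  shows "integrable (ws_space N) (\<lambda>x. \<Prod>k<N. laguerre_bound M c (x k))"
proof -
  interpret product_sigma_finite "\<lambda>_::nat. lborel :: real measure" by (rule ws_space_sigma)
  show ?thesis unfolding ws_space_def
    by (intro product_integrable_prod) (auto intro: integrable_laguerre_bound assms)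
qed

lemma integrable_dominated:
  assumes "\<beta> \<ge> 1" "real D + 1 \<le> \<beta> * real N / 2" and G: "dominated N D G"
  shows "integrable (ws_space N) (\<lambda>x. G x * ws_weight \<beta> N x)"
    and "a < b \<Longrightarrow> b < N \<Longrightarrow> integrable (ws_space N) (\<lambda>x. G x * (ws_weight \<beta> N x / (x a - x b)))"
proof -
  obtain K M where KM: "K \<ge> 0"
    "\<And>x. \<bar>G x * ws_weight \<beta> N x\<bar> \<le> K * (\<Prod>k<N. laguerre_bound M (\<beta> * real N / 2) (x k))"
    "\<And>x a b. a < b \<Longrightarrow> b < N \<Longrightarrow> \<bar>G x * (ws_weight \<beta> N x / (x a - x b))\<bar>
        \<le> K * (\<Prod>k<N. laguerre_bound M (\<beta> * real N / 2) (x k))"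
    using dominated_ws_weight_le[OF assms] by blast
  have c: "\<beta> * real N / 2 > 0" using assms(2) by linarith
  have int: "integrable (ws_space N) (\<lambda>x. K * (\<Prod>k<N. laguerre_bound M (\<beta> * real N / 2) (x k)))"
    by (intro integrable_mult_right integrable_prod_laguerre_bound c)
  have nn: "0 \<le> (\<Prod>k<N. laguerre_bound M (\<beta> * real N / 2) (x k))" for x
    by (intro prod_nonneg) (simp add: laguerre_bound_nonneg)
  have mG: "G \<in> borel_measurable (ws_space N)" using G by (simp add: dominated_def)
  note [measurable] = mG measurable_ws_weight[of \<beta> N]
  show "integrable (ws_space N) (\<lambda>x. G x * ws_weight \<beta> N x)"
    using KM(1,2) nn by (intro Bochner_Integration.integrable_bound[OF int] AE_I2) auto
  show "integrable (ws_space N) (\<lambda>x. G x * (ws_weight \<beta> N x / (x a - x b)))" if "a < b" "b < N"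
  proof (rule Bochner_Integration.integrable_bound[OF int])
    have [measurable]: "(\<lambda>x. x a) \<in> borel_measurable (ws_space N)" "(\<lambda>x. x b) \<in> borel_measurable (ws_space N)"
      using that by (auto intro: measurable_ws_component)
    show "(\<lambda>x. G x * (ws_weight \<beta> N x / (x a - x b))) \<in> borel_measurable (ws_space N)" by measurable
    show "AE x in ws_space N. norm (G x * (ws_weight \<beta> N x / (x a - x b)))
        \<le> norm (K * (\<Prod>k<N. laguerre_bound M (\<beta> * real N / 2) (x k)))"
      using KM(3)[OF that] nn KM(1) by (intro AE_I2) (simp only: real_norm_def abs_of_nonneg mult_nonneg_nonneg)
  qed
qed

section \<open>Integration by parts and the loop equation\<close>

text \<open>Logarithmic derivatives add up over a product. Stating them through
  \<open>f s y * l s\<close> avoids a division by factors that may vanish.\<close>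

lemma has_real_derivative_prod_log:
  fixes f :: "'a \<Rightarrow> real \<Rightarrow> real"
  assumes "\<And>s. s \<in> A \<Longrightarrow> (f s has_real_derivative f s y * l s) (at y)"
  shows "((\<lambda>y. \<Prod>s\<in>A. f s y) has_real_derivative (\<Prod>s\<in>A. f s y) * (\<Sum>s\<in>A. l s)) (at y)"
  using assms
proof (induction A rule: infinite_finite_induct)
  case (insert s A)
  have "((\<lambda>y. f s y * (\<Prod>s\<in>A. f s y)) has_real_derivative
      f s y * ((\<Prod>s\<in>A. f s y) * (\<Sum>s\<in>A. l s)) + f s y * l s * (\<Prod>s\<in>A. f s y)) (at y)"
    using DERIV_mult'[OF insert.prems[of s] insert.IH] insert.prems by auto
  then show ?case using insert.hyps by (simp add: algebra_simps)
qed auto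

lemma has_real_derivative_abs_powr:
  fixes t :: real
  assumes "t \<noteq> 0"
  shows "((\<lambda>t. \<bar>t\<bar> powr \<beta>) has_real_derivative \<bar>t\<bar> powr \<beta> * (\<beta> / t)) (at t)"
proof (cases "t > 0")
  case True
  have "((\<lambda>t. t powr \<beta>) has_real_derivative \<bar>t\<bar> powr \<beta> * (\<beta> / t)) (at t)"
    using True by (auto intro!: derivative_eq_intros simp: powr_diff)
  then show ?thesis
    by (rule has_field_derivative_transform_within_open[of _ _ _ "{0<..}"]) (use True in auto)
next
  case False
  have "((\<lambda>t. (- t) powr \<beta>) has_real_derivative \<bar>t\<bar> powr \<beta> * (\<beta> / t)) (at t)"
    using False assms by (auto intro!: derivative_eq_intros simp: powr_diff)
  then show ?thesis
    by (rule has_field_derivative_transform_within_open[of _ _ _ "{..<0}"]) (use False assms in auto)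
qed

text \<open>The logarithmic derivative of the density in x_i. The signed indicators keep the sum
  over the pairs a < b of the Vandermonde product, so that a later summation over i leaves two terms
  for each pair.\<close>

definition ws_drift :: "real \<Rightarrow> nat \<Rightarrow> nat \<Rightarrow> (nat \<Rightarrow> real) \<Rightarrow> real" where
  "ws_drift \<beta> N i z = (\<Sum>a<N. \<Sum>b\<in>{a<..<N}. \<beta> * (of_bool (a = i) - of_bool (b = i)) / (z a - z b))
     + (\<beta> * real N / 2 / z i - \<beta> * real N / 2)"

lemma ws_weight_has_derivative:
  fixes x :: "nat \<Rightarrow> real"
  assumes i: "i < N" and y: "y > 0" "\<And>j. j < N \<Longrightarrow> j \<noteq> i \<Longrightarrow> y \<noteq> x j"
  shows "((\<lambda>y. ws_weight \<beta> N (x(i := y))) has_real_derivative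
     ws_weight \<beta> N (x(i := y)) * ws_drift \<beta> N i (x(i := y))) (at y)"
proof (cases "\<forall>k<N. k \<noteq> i \<longrightarrow> x k > 0")
  case False
  then have "ws_weight \<beta> N (x(i := t)) = 0" for t
    by (intro ws_weight_off_orthant) auto
  then show ?thesis by simp
next
  case True
  define c where "c = \<beta> * real N / 2"
  \<comment> \<open>The formula of the density without its case distinction. The two agree on the
    open half-line, which is enough for derivatives.\<close>
  define w where "w y = vandermonde_power \<beta> N (x(i := y)) *
     (\<Prod>k<N. (x(i := y)) k powr c * exp (- c * (x(i := y)) k))" for y
  have w: "w t = ws_weight \<beta> N (x(i := t))" if "t > 0" for t
  proof -
    have "\<forall>k<N. (x(i := t)) k > 0" using True that by auto
    then show ?thesis unfolding w_def c_def by (rule ws_weight_on_orthant[symmetric])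
  qed
  have pair: "((\<lambda>y. \<bar>(x(i := y)) a - (x(i := y)) b\<bar> powr \<beta>) has_real_derivative
      \<bar>(x(i := y)) a - (x(i := y)) b\<bar> powr \<beta> *
      (\<beta> * (of_bool (a = i) - of_bool (b = i)) / ((x(i := y)) a - (x(i := y)) b))) (at y)"
    if ab: "a < b" "b < N" for a b
  proof -
    consider "a = i" | "b = i" | "a \<noteq> i" "b \<noteq> i" by blast
    then show ?thesis
    proof cases
      case 1
      have "((\<lambda>y. \<bar>y - x b\<bar> powr \<beta>) has_real_derivative \<bar>y - x b\<bar> powr \<beta> * (\<beta> / (y - x b)) * 1) (at y)"
        using y(2)[of b] 1 ab
        by (intro DERIV_chain2[where g = "\<lambda>y. y - x b", OF has_real_derivative_abs_powr]) (auto intro!: derivative_eq_intros)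
      then show ?thesis using 1 ab by simp
    next
      case 2
      have "((\<lambda>y. \<bar>x a - y\<bar> powr \<beta>) has_real_derivative \<bar>x a - y\<bar> powr \<beta> * (\<beta> / (x a - y)) * (- 1)) (at y)"
        using y(2)[of a] 2 ab
        by (intro DERIV_chain2[where g = "\<lambda>y. x a - y", OF has_real_derivative_abs_powr]) (auto intro!: derivative_eq_intros)
      then show ?thesis using 2 ab by simp
    next
      case 3
      then show ?thesis by simp
    qed
  qed
  have single: "((\<lambda>y. (x(i := y)) k powr c * exp (- c * (x(i := y)) k)) has_real_derivative
      ((x(i := y)) k powr c * exp (- c * (x(i := y)) k)) * (if k = i then c / y - c else 0)) (at y)" for k
  proof (cases "k = i")
    case True
    then show ?thesis using y(1)
      by (auto intro!: derivative_eq_intros simp: powr_diff algebra_simps)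
  qed simp
  have "(w has_real_derivative w y * ((\<Sum>a<N. \<Sum>b\<in>{a<..<N}. \<beta> * (of_bool (a = i) - of_bool (b = i)) /
        ((x(i := y)) a - (x(i := y)) b)) + (\<Sum>k<N. if k = i then c / y - c else 0))) (at y)"
  proof -
    have dV: "((\<lambda>y. vandermonde_power \<beta> N (x(i := y))) has_real_derivative vandermonde_power \<beta> N (x(i := y)) *
        (\<Sum>a<N. \<Sum>b\<in>{a<..<N}. \<beta> * (of_bool (a = i) - of_bool (b = i)) / ((x(i := y)) a - (x(i := y)) b))) (at y)"
      by (intro has_real_derivative_prod_log pair) auto
    have dP: "((\<lambda>y. \<Prod>k<N. (x(i := y)) k powr c * exp (- c * (x(i := y)) k)) has_real_derivative
        (\<Prod>k<N. (x(i := y)) k powr c * exp (- c * (x(i := y)) k)) * (\<Sum>k<N. if k = i then c / y - c else 0)) (at y)"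
      by (rule has_real_derivative_prod_log) (rule single)
    have alg: "v * (p * t) + v * s * p = v * p * (s + t)" for v p s t :: real by (simp add: algebra_simps)
    show ?thesis unfolding w_def by (rule DERIV_cong[OF DERIV_mult'[OF dV dP]]) (rule alg)
  qed
  moreover have "(\<Sum>k<N. if k = i then c / y - c else 0) = c / y - c" using i by simp
  ultimately have "(w has_real_derivative w y * ws_drift \<beta> N i (x(i := y))) (at y)"
    by (simp add: ws_drift_def c_def)
  then have "((\<lambda>y. ws_weight \<beta> N (x(i := y))) has_real_derivative w y * ws_drift \<beta> N i (x(i := y))) (at y)"
    by (rule has_field_derivative_transform_within_open[of _ _ _ "{0<..}"]) (use y w in auto)
  then show ?thesis using w[OF y(1)] by simp
qed

lemma continuous_on_fun_upd: "continuous_on A (\<lambda>y::real. (x(i := y)) a)"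
  by (cases "a = i") (simp_all add: continuous_on_id)

text \<open>This includes the points where y meets another coordinate, at which the derivative may
  fail to exist: |t|^\<beta> is continuous at 0 for \<beta> > 0.\<close>

lemma ws_weight_continuous:
  fixes x :: "nat \<Rightarrow> real"
  assumes "\<beta> > 0"
  shows "continuous_on {0<..} (\<lambda>y. ws_weight \<beta> N (x(i := y)))"
proof (cases "\<forall>k<N. k \<noteq> i \<longrightarrow> x k > 0")
  case False
  then have "ws_weight \<beta> N (x(i := t)) = 0" for t
    by (intro ws_weight_off_orthant) auto
  then show ?thesis by simp
next
  case True
  define c where "c = \<beta> * real N / 2"
  define w where "w y = vandermonde_power \<beta> N (x(i := y)) *
     (\<Prod>k<N. (x(i := y)) k powr c * exp (- c * (x(i := y)) k))" for y
  have pos: "(x(i := t)) k > 0" if "t > 0" "k < N" for t k using True that by auto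
  have w: "w t = ws_weight \<beta> N (x(i := t))" if "t \<in> {0<..}" for t
  proof -
    have "\<forall>k<N. (x(i := t)) k > 0" using True that by auto
    then show ?thesis unfolding w_def c_def by (rule ws_weight_on_orthant[symmetric])
  qed
  have "continuous_on {0<..} w"
  proof -
    have "continuous_on {0<..} (\<lambda>y. \<bar>(x(i := y)) a - (x(i := y)) b\<bar> powr \<beta>)" for a b
      using assms
      by (intro continuous_on_powr' continuous_on_rabs continuous_on_diff continuous_on_fun_upd continuous_on_const)
        auto
    moreover have "continuous_on {0<..} (\<lambda>y. (x(i := y)) k powr c * exp (- c * (x(i := y)) k))" if "k < N" for k
    proof -
      have "(x(i := t)) k \<noteq> 0" if "t \<in> {0<..}" for t
        using pos[of t k] that \<open>k < N\<close> by simp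
      then show ?thesis
        by (intro continuous_on_mult continuous_on_powr continuous_on_exp continuous_on_fun_upd continuous_on_const) auto
    qed
    ultimately show ?thesis
      unfolding w_def by (intro continuous_on_mult[OF continuous_on_prod continuous_on_prod] continuous_on_prod) auto
  qed
  then show ?thesis by (rule continuous_on_eq) (rule w)
qed

lemma has_real_derivative_inverse_power:
  fixes y :: real
  assumes "y \<noteq> 0"
  shows "((\<lambda>y. 1 / y ^ k) has_real_derivative - real k * (1 / y ^ Suc k)) (at y)"
proof (cases k)
  case (Suc n)
  then show ?thesis using assms
    by (auto intro!: derivative_eq_intros simp: field_simps) (cases n, auto)
qed simp

lemma ws_T_has_derivative:
  assumes "i < N" "y > 0"
  shows "((\<lambda>y. ws_T k N (x(i := y))) has_real_derivative - (real k / real N) * (1 / y ^ (k + 1))) (at y)"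
proof -
  have "((\<lambda>y. 1 / (x(i := y)) j ^ k) has_real_derivative (if j = i then - real k * (1 / y ^ (k + 1)) else 0)) (at y)" for j
  proof (cases "j = i")
    case True
    have "((\<lambda>y. 1 / y ^ k) has_real_derivative - real k * (1 / y ^ Suc k)) (at y)"
      using assms(2) by (intro has_real_derivative_inverse_power) simp
    then show ?thesis using True by simp
  qed simp
  then have "((\<lambda>y. \<Sum>j<N. 1 / (x(i := y)) j ^ k) has_real_derivative
      (\<Sum>j<N. if j = i then - real k * (1 / y ^ (k + 1)) else 0)) (at y)"
    by (intro DERIV_sum) auto
  from DERIV_cmult[OF this, of "1 / real N"] show ?thesis
    using assms by (simp add: ws_T_def)
qed

section \<open>Integration by parts in one coordinate\<close>

text \<open>Fubini in the i-th coordinate. A section that is not integrable has integral 0 by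
  convention, so \<open>inner\<close> has to treat the integrable sections only.\<close>

lemma integral_ws_space_eq_0:
  fixes f :: "(nat \<Rightarrow> real) \<Rightarrow> real"
  assumes i: "i < N" and int: "integrable (ws_space N) f"
    and inner: "\<And>x. integrable lborel (\<lambda>y. f (x(i := y))) \<Longrightarrow> (\<integral>y. f (x(i := y)) \<partial>lborel) = 0"
  shows "(\<integral>x. f x \<partial>ws_space N) = 0"
proof -
  interpret product_sigma_finite "\<lambda>_::nat. lborel :: real measure" by (rule ws_space_sigma)
  have ins: "insert i ({..<N} - {i}) = {..<N}" using i by auto
  have "(\<integral>y. f (x(i := y)) \<partial>lborel) = 0" for x
    using inner[of x] not_integrable_integral_eq by blast
  moreover have "(\<integral>x. f x \<partial>ws_space N) =
      (\<integral>x. (\<integral>y. f (x(i := y)) \<partial>lborel) \<partial>Pi\<^sub>M ({..<N} - {i}) (\<lambda>_. lborel))"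
    using int unfolding ws_space_def
    by (intro product_integral_insert[of "{..<N} - {i}" i f, unfolded ins]) auto
  ultimately show ?thesis by simp
qed

text \<open>Differentiating G, and multiplying it by the term 1 / x_i of the drift, both raise the
  pole order to D + 1; integrability asks for one more, hence D + 2.\<close>

lemma ws_integration_by_parts:
  assumes \<beta>: "\<beta> \<ge> 1" and D: "real D + 2 \<le> \<beta> * real N / 2" and i: "i < N"
    and G: "dominated N D G" and G': "dominated N (Suc D) G'"
    and deriv: "\<And>x y. y > 0 \<Longrightarrow> ((\<lambda>y. G (x(i := y))) has_real_derivative G' (x(i := y))) (at y)"
  shows "integrable (ws_space N) (\<lambda>x. G' x * ws_weight \<beta> N x + G x * (ws_weight \<beta> N x * ws_drift \<beta> N i x))" (is "integrable _ ?f")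
    and "(\<integral>x. G' x * ws_weight \<beta> N x + G x * (ws_weight \<beta> N x * ws_drift \<beta> N i x) \<partial>ws_space N) = 0"
proof -
  define c where "c = \<beta> * real N / 2"
  have D1: "real (Suc D) + 1 \<le> \<beta> * real N / 2" and D0: "real D + 1 \<le> \<beta> * real N / 2" using D by auto
  have c0: "c > 0" using D by (simp add: c_def)
  \<comment> \<open>The drift is expanded so that each summand is a dominated function times the
    density or times the density divided by one difference, the two kinds covered by
    \<open>integrable_dominated\<close>.\<close>
  have eq: "?f x = G' x * ws_weight \<beta> N x
     + (\<Sum>a<N. \<Sum>b\<in>{a<..<N}. \<beta> * (of_bool (a = i) - of_bool (b = i)) * (G x * (ws_weight \<beta> N x / (x a - x b))))
     + c * (G x * (1 / x i ^ 1) * ws_weight \<beta> N x) - c * (G x * ws_weight \<beta> N x)" for x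
    by (simp add: ws_drift_def c_def sum_distrib_left algebra_simps)
  have "dominated N (D + 1) (\<lambda>x. G x * (1 / x i ^ 1))"
    by (intro dominated_mult G dominated_inverse_power i)
  then have "dominated N (Suc D) (\<lambda>x. G x * (1 / x i ^ 1))" by simp
  then show int: "integrable (ws_space N) ?f"
    unfolding eq
    by (intro Bochner_Integration.integrable_add Bochner_Integration.integrable_diff
        Bochner_Integration.integrable_sum integrable_mult_right
        integrable_dominated(1)[OF \<beta> D1] integrable_dominated(1)[OF \<beta> D0 G]
        integrable_dominated(2)[OF \<beta> D0 G] G') auto
  show "(\<integral>x. ?f x \<partial>ws_space N) = 0"
  proof (rule integral_ws_space_eq_0[OF i int])
    fix x :: "nat \<Rightarrow> real"
    assume int1: "integrable lborel (\<lambda>y. ?f (x(i := y)))"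
    obtain K M where K: "K \<ge> 0" and KM:
      "\<And>x. \<bar>G x * ws_weight \<beta> N x\<bar> \<le> K * (\<Prod>k<N. laguerre_bound M c (x k))"
      using dominated_ws_weight_le[OF \<beta> D0 G] unfolding c_def by blast
    define C where "C = (\<Prod>k\<in>{..<N} - {i}. laguerre_bound M c (x k))"
    have "(\<Prod>k<N. laguerre_bound M c ((x(i := y)) k)) = laguerre_bound M c y * C" for y
      using i by (subst prod.remove[of _ i]) (auto simp: C_def)
    then have bound: "norm (G (x(i := y)) * ws_weight \<beta> N (x(i := y))) \<le> K * (laguerre_bound M c y * C)" for y
      using KM[of "x(i := y)"] by simp
    \<comment> \<open>On the line through x the product is at most a constant multiple of
      \<open>laguerre_bound M c\<close>, so it vanishes at both ends of the half-line.\<close>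
    have lim: "((\<lambda>y. G (x(i := y)) * ws_weight \<beta> N (x(i := y))) \<longlongrightarrow> 0) F"
      if "(laguerre_bound M c \<longlongrightarrow> 0) F" for F
    proof (rule Lim_null_comparison[OF always_eventually])
      show "((\<lambda>y. K * (laguerre_bound M c y * C)) \<longlongrightarrow> 0) F"
        by (intro tendsto_mult_right_zero tendsto_mult_left_zero that)
    qed (use bound in blast)
    show "(\<integral>y. ?f (x(i := y)) \<partial>lborel) = 0"
    proof (rule integral_derivative_half_line_eq_0[where E = "x ` {..<N}" and
          f = "\<lambda>y. G (x(i := y)) * ws_weight \<beta> N (x(i := y))"])
      show "((\<lambda>y. G (x(i := y)) * ws_weight \<beta> N (x(i := y))) has_real_derivative ?f (x(i := y))) (at y)"
        if "y > 0" "y \<notin> x ` {..<N}" for y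
      proof -
        have "((\<lambda>y. ws_weight \<beta> N (x(i := y))) has_real_derivative
            ws_weight \<beta> N (x(i := y)) * ws_drift \<beta> N i (x(i := y))) (at y)"
          using that by (intro ws_weight_has_derivative i) auto
        from DERIV_mult'[OF deriv[OF that(1)] this] show ?thesis
          by (rule DERIV_cong) (rule add.commute)
      qed
      have "continuous_on {0<..} (\<lambda>y. G (x(i := y)))"
        by (rule DERIV_continuous_on, rule has_field_derivative_at_within, rule deriv) simp
      then show "continuous_on {0<..} (\<lambda>y. G (x(i := y)) * ws_weight \<beta> N (x(i := y)))"
        using \<beta> by (intro continuous_on_mult ws_weight_continuous) auto
      show "?f (x(i := y)) = 0" if "y \<le> 0" for y
      proof -
        have "ws_weight \<beta> N (x(i := y)) = 0"
          using that i by (intro ws_weight_off_orthant) auto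
        then show ?thesis by simp
      qed
    qed (auto intro: int1 lim laguerre_bound_at_right_0 laguerre_bound_at_top c0)
  qed
qed

section \<open>Divergence of the vector field\<close>

lemma sum_symmetric_pairs:
  fixes H :: "nat \<Rightarrow> nat \<Rightarrow> real"
  assumes sym: "\<And>a b. H a b = H b a"
  shows "(\<Sum>a<N. \<Sum>b<N. H a b) = 2 * (\<Sum>a<N. \<Sum>b\<in>{a<..<N}. H a b) + (\<Sum>a<N. H a a)"
proof (induction N)
  case (Suc N)
  have ins: "{a<..<Suc N} = insert N {a<..<N}" if "a < N" for a using that by auto
  have "(\<Sum>a<Suc N. \<Sum>b\<in>{a<..<Suc N}. H a b) = (\<Sum>a<N. \<Sum>b\<in>{a<..<Suc N}. H a b)"
    by (simp add: greaterThanLessThan_empty_iff2 flip: atLeastSucLessThan_greaterThanLessThan)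
  also have "\<dots> = (\<Sum>a<N. H a N + (\<Sum>b\<in>{a<..<N}. H a b))"
    by (rule sum.cong) (auto simp: ins)
  finally have "(\<Sum>a<Suc N. \<Sum>b\<in>{a<..<Suc N}. H a b) = (\<Sum>a<N. H a N) + (\<Sum>a<N. \<Sum>b\<in>{a<..<N}. H a b)"
    by (simp add: sum.distrib)
  moreover have "(\<Sum>b<N. H N b) = (\<Sum>b<N. H b N)" using sym by simp
  ultimately show ?case using Suc by (simp add: sum.distrib)
qed simp

text \<open>With u = 1/x and v = 1/y one has u - v = -(x - y) u v, so x - y cancels in the
  factorisation of u^k - v^k. Hence the singular interaction becomes a combination of inverse
  powers, all with exponents at least 1.\<close>

lemma inverse_power_difference_quotient:
  fixes x y :: real
  assumes "x > 0" "y > 0" "x \<noteq> y"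
  shows "(1 / x ^ k - 1 / y ^ k) / (x - y) = - (\<Sum>c<k. 1 / x ^ Suc c * (1 / y ^ (k - c)))"
proof -
  define u v where "u = 1 / x" and "v = 1 / y"
  have "1 / x ^ k - 1 / y ^ k = u ^ k - v ^ k" by (simp add: u_def v_def power_one_over)
  also have "\<dots> = (u - v) * (\<Sum>c<k. v ^ (k - Suc c) * u ^ c)" by (rule power_diff_sumr2)
  also have "u - v = - (x - y) * (u * v)" using assms by (simp add: u_def v_def field_simps)
  finally have "(1 / x ^ k - 1 / y ^ k) / (x - y) = - (u * v * (\<Sum>c<k. v ^ (k - Suc c) * u ^ c))"
    using assms(3) by (simp add: field_simps)
  also have "u * v * (\<Sum>c<k. v ^ (k - Suc c) * u ^ c) = (\<Sum>c<k. u ^ Suc c * v ^ (k - c))"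
    unfolding sum_distrib_left
  proof (rule sum.cong[OF refl])
    fix c assume "c \<in> {..<k}"
    then have "k - c = Suc (k - Suc c)" by auto
    then show "u * v * (v ^ (k - Suc c) * u ^ c) = u ^ Suc c * v ^ (k - c)" by simp
  qed
  finally show ?thesis by (simp add: u_def v_def power_one_over)
qed

text \<open>Each pair contributes -\<beta> H a b. Extending the sum over a < b to all ordered pairs
  costs the factor 1/2 and the diagonal H a a, whose total k p (Suc k) later combines with the
  derivative of z_i^(-k) into the correction 1 - 2/\<beta>.\<close>

lemma sum_ws_drift:
  fixes z :: "nat \<Rightarrow> real"
  assumes pos: "\<forall>k<N. z k > 0" and dist: "\<And>a b. a < b \<Longrightarrow> b < N \<Longrightarrow> z a \<noteq> z b"
  defines "p j \<equiv> \<Sum>i<N. 1 / z i ^ j"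
  shows "(\<Sum>i<N. 1 / z i ^ k * ws_drift \<beta> N i z) =
     - (\<beta> / 2) * ((\<Sum>c<k. p (Suc c) * p (k - c)) - real k * p (Suc k)) + \<beta> * real N / 2 * (p (Suc k) - p k)"
proof -
  define H where "H a b = (\<Sum>c<k. 1 / z a ^ Suc c * (1 / z b ^ (k - c)))" for a b
  \<comment> \<open>Replacing c by k - 1 - c exchanges the two exponents.\<close>
  have sym: "H a b = H b a" for a b
    unfolding H_def
  proof (subst sum.nat_diff_reindex[symmetric], rule sum.cong[OF refl])
    fix c assume "c \<in> {..<k}"
    then have "Suc (k - Suc c) = k - c" "k - (k - Suc c) = Suc c" by auto
    then show "1 / z a ^ Suc (k - Suc c) * (1 / z b ^ (k - (k - Suc c))) = 1 / z b ^ Suc c * (1 / z a ^ (k - c))"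
      by (simp only: mult.commute)
  qed
  have diag: "(\<Sum>a<N. H a a) = real k * p (Suc k)"
  proof -
    have "H a a = real k * (1 / z a ^ Suc k)" for a
    proof -
      have "1 / z a ^ Suc c * (1 / z a ^ (k - c)) = 1 / z a ^ Suc k" if "c < k" for c
      proof -
        have "Suc k = Suc c + (k - c)" using that by simp
        then show ?thesis by (simp only: power_add) simp
      qed
      then have "H a a = (\<Sum>c<k. 1 / z a ^ Suc k)" unfolding H_def by (intro sum.cong) auto
      then show ?thesis by simp
    qed
    then show ?thesis by (simp only: p_def sum_distrib_left)
  qed
  have full: "(\<Sum>a<N. \<Sum>b<N. H a b) = (\<Sum>c<k. p (Suc c) * p (k - c))"
  proof -
    have "(\<Sum>a<N. \<Sum>b<N. H a b) = (\<Sum>a<N. \<Sum>c<k. \<Sum>b<N. 1 / z a ^ Suc c * (1 / z b ^ (k - c)))"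
      unfolding H_def by (intro sum.cong[OF refl] sum.swap)
    also have "\<dots> = (\<Sum>c<k. \<Sum>a<N. \<Sum>b<N. 1 / z a ^ Suc c * (1 / z b ^ (k - c)))" by (rule sum.swap)
    finally show ?thesis unfolding p_def sum_product .
  qed
  have "(\<Sum>i<N. 1 / z i ^ k * (\<Sum>a<N. \<Sum>b\<in>{a<..<N}. \<beta> * (of_bool (a = i) - of_bool (b = i)) / (z a - z b)))
      = (\<Sum>a<N. \<Sum>b\<in>{a<..<N}. \<Sum>i<N. 1 / z i ^ k * (\<beta> * (of_bool (a = i) - of_bool (b = i)) / (z a - z b)))"
    unfolding sum_distrib_left
    by (subst sum.swap, intro sum.cong[OF refl], rule sum.swap)
  also have "\<dots> = (\<Sum>a<N. \<Sum>b\<in>{a<..<N}. - \<beta> * H a b)"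
  proof (intro sum.cong[OF refl])
    fix a b assume ab: "a \<in> {..<N}" "b \<in> {a<..<N}"
    have pick: "(\<Sum>i<N. 1 / z i ^ k * of_bool (d = i)) = 1 / z d ^ k" if "d < N" for d
      using that by (simp add: of_bool_def if_distrib cong: if_cong)
    have "(\<Sum>i<N. 1 / z i ^ k * (\<beta> * (of_bool (a = i) - of_bool (b = i)) / (z a - z b)))
        = \<beta> / (z a - z b) * ((\<Sum>i<N. 1 / z i ^ k * of_bool (a = i)) - (\<Sum>i<N. 1 / z i ^ k * of_bool (b = i)))"
      unfolding sum_subtractf[symmetric] sum_distrib_left by (rule sum.cong) (auto simp: algebra_simps diff_divide_distrib)
    also have "\<dots> = \<beta> * ((1 / z a ^ k - 1 / z b ^ k) / (z a - z b))"
    proof -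
      have "a < N" "b < N" using ab by auto
      then show ?thesis unfolding pick[OF \<open>a < N\<close>] pick[OF \<open>b < N\<close>] by simp
    qed
    also have "\<dots> = - \<beta> * H a b"
      unfolding H_def using ab pos dist[of a b] by (subst inverse_power_difference_quotient) auto
    finally show "(\<Sum>i<N. 1 / z i ^ k * (\<beta> * (of_bool (a = i) - of_bool (b = i)) / (z a - z b))) = - \<beta> * H a b" .
  qed
  also have "\<dots> = - \<beta> * (\<Sum>a<N. \<Sum>b\<in>{a<..<N}. H a b)" by (simp only: sum_distrib_left)
  also have "\<dots> = - (\<beta> / 2) * ((\<Sum>c<k. p (Suc c) * p (k - c)) - real k * p (Suc k))"
    using sum_symmetric_pairs[of H N, OF sym] unfolding full diag by simp
  finally have 1: "(\<Sum>i<N. 1 / z i ^ k * (\<Sum>a<N. \<Sum>b\<in>{a<..<N}. \<beta> * (of_bool (a = i) - of_bool (b = i)) / (z a - z b)))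
     = - (\<beta> / 2) * ((\<Sum>c<k. p (Suc c) * p (k - c)) - real k * p (Suc k))" .
  have 2: "(\<Sum>i<N. 1 / z i ^ k * (\<beta> * real N / 2 / z i - \<beta> * real N / 2)) = \<beta> * real N / 2 * (p (Suc k) - p k)"
    unfolding p_def sum_subtractf[symmetric] sum_distrib_left
  proof (rule sum.cong[OF refl])
    fix i assume "i \<in> {..<N}"
    then have "z i \<noteq> 0" using pos by force
    then show "1 / z i ^ k * (\<beta> * real N / 2 / z i - \<beta> * real N / 2) = \<beta> * real N / 2 * (1 / z i ^ Suc k - 1 / z i ^ k)"
      by (simp add: field_simps)
  qed
  show ?thesis
    unfolding ws_drift_def distrib_left[of "1 / _"] sum.distrib 1 2 ..
qed

abbreviation T_prod :: "nat \<Rightarrow> nat multiset \<Rightarrow> (nat \<Rightarrow> real) \<Rightarrow> real" where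
  "T_prod N A x \<equiv> (\<Prod>k\<in>#A. ws_T k N x)"

lemma T_prod_mset_on: "T_prod N (mset_on \<kappa> S) x = (\<Prod>j\<in>S. ws_T (\<kappa> j) N x)"
  by (simp add: mset_on_def prod_unfold_prod_mset multiset.map_comp comp_def)

lemma dominated_T_prod: "dominated N (sum_mset A) (T_prod N A)"
  by (induction A) (auto intro: dominated_const dominated_mult dominated_ws_T)

lemma integrable_T_prod:
  assumes "\<beta> \<ge> 1" "real (sum_mset A) + 1 \<le> \<beta> * real N / 2"
  shows "integrable (ws_space N) (\<lambda>x. T_prod N A x * ws_weight \<beta> N x)"
  using integrable_dominated(1)[OF assms dominated_T_prod] .

text \<open>A nonzero density forces the coordinates to be positive and distinct, as
  \<open>sum_ws_drift\<close> requires. The scale \<beta> N^2 / 2 is the leading coefficient of the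
  T_(k+1) term: the drift supplies \<beta> N / 2, and the inverse power sum is N T_(k+1).\<close>

lemma sum_T_vector_field:
  fixes z :: "nat \<Rightarrow> real" and \<kappa> :: "nat \<Rightarrow> nat"
  assumes N: "N > 0" and \<beta>: "\<beta> > 0" and fin: "finite S"
    and w: "ws_weight \<beta> N z \<noteq> 0"
  shows "(\<Sum>i<N. (- real k * (1 / z i ^ Suc k) * T_prod N (mset_on \<kappa> S) z
          + 1 / z i ^ k * (\<Sum>j\<in>S. - (real (\<kappa> j) / real N) * (1 / z i ^ (\<kappa> j + 1)) * T_prod N (mset_on \<kappa> (S - {j})) z))
        + 1 / z i ^ k * T_prod N (mset_on \<kappa> S) z * ws_drift \<beta> N i z)
     = \<beta> * (real N)\<^sup>2 / 2 *
        ((1 + real k / real N * (1 - 2 / \<beta>)) * T_prod N (add_mset (Suc k) (mset_on \<kappa> S)) z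
         - T_prod N (add_mset k (mset_on \<kappa> S)) z
         - (\<Sum>c<k. T_prod N (add_mset (Suc c) (add_mset (k - c) (mset_on \<kappa> S))) z)
         - 2 / (\<beta> * (real N)\<^sup>2) * (\<Sum>j\<in>S. real (\<kappa> j) * T_prod N (add_mset (\<kappa> j + k + 1) (mset_on \<kappa> (S - {j}))) z))"
proof -
  have pos: "\<forall>k<N. z k > 0" using w ws_weight_off_orthant by blast
  have dist: "z a \<noteq> z b" if "a < b" "b < N" for a b
  proof
    assume "z a = z b"
    then have z0: "(\<Prod>j\<in>{a<..<N}. \<bar>z a - z j\<bar> powr \<beta>) = 0"
      using that by (intro prod_zero bexI[of _ b]) auto
    have "a < N" using that by simp
    then have "\<exists>i\<in>{..<N}. (\<Prod>j\<in>{i<..<N}. \<bar>z i - z j\<bar> powr \<beta>) = 0"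
      by (intro bexI[of _ a] z0) simp
    then have "vandermonde_power \<beta> N z = 0"
      by (rule prod_zero[OF finite_lessThan])
    then show False using w ws_weight_on_orthant[OF pos, of \<beta>] by simp
  qed
  define F where "F = T_prod N (mset_on \<kappa> S) z"
  define T where "T j = ws_T j N z" for j
  define R where "R = (\<Sum>j\<in>S. real (\<kappa> j) * (T (\<kappa> j + k + 1) * T_prod N (mset_on \<kappa> (S - {j})) z))"
  have p: "(\<Sum>i<N. 1 / z i ^ j) = real N * T j" for j using N by (simp add: T_def ws_T_def)
  have "(\<Sum>i<N. 1 / z i ^ k * (\<Sum>j\<in>S. - (real (\<kappa> j) / real N) * (1 / z i ^ (\<kappa> j + 1)) * T_prod N (mset_on \<kappa> (S - {j})) z))
      = (\<Sum>j\<in>S. \<Sum>i<N. - (real (\<kappa> j) / real N) * T_prod N (mset_on \<kappa> (S - {j})) z * (1 / z i ^ (\<kappa> j + k + 1)))"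
    unfolding sum_distrib_left by (subst sum.swap) (simp add: power_add mult_ac)
  also have "\<dots> = (\<Sum>j\<in>S. - (real (\<kappa> j) / real N) * T_prod N (mset_on \<kappa> (S - {j})) z * (real N * T (\<kappa> j + k + 1)))"
    unfolding sum_distrib_left[symmetric] p ..
  also have "\<dots> = - R" using N by (simp add: R_def sum_negf mult_ac)
  finally have 1: "(\<Sum>i<N. 1 / z i ^ k * (\<Sum>j\<in>S. - (real (\<kappa> j) / real N) * (1 / z i ^ (\<kappa> j + 1)) * T_prod N (mset_on \<kappa> (S - {j})) z)) = - R" .
  have 2: "(\<Sum>i<N. - real k * (1 / z i ^ Suc k) * F) = - real k * (real N * T (Suc k)) * F"
    unfolding sum_distrib_left[symmetric] sum_distrib_right[symmetric] p ..
  have "(\<Sum>i<N. 1 / z i ^ k * F * ws_drift \<beta> N i z) = F * (\<Sum>i<N. 1 / z i ^ k * ws_drift \<beta> N i z)"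
    unfolding sum_distrib_left by (simp add: mult_ac)
  also have "\<dots> = F * (- (\<beta> / 2) * ((\<Sum>c<k. real N * T (Suc c) * (real N * T (k - c))) - real k * (real N * T (Suc k)))
      + \<beta> * real N / 2 * (real N * T (Suc k) - real N * T k))"
    using sum_ws_drift[OF pos dist, of k \<beta>] unfolding p by simp
  also have "(\<Sum>c<k. real N * T (Suc c) * (real N * T (k - c))) = (real N)\<^sup>2 * (\<Sum>c<k. T (Suc c) * T (k - c))"
    by (simp add: sum_distrib_left power2_eq_square mult_ac)
  finally have 3: "(\<Sum>i<N. 1 / z i ^ k * F * ws_drift \<beta> N i z)
      = F * (- (\<beta> / 2) * ((real N)\<^sup>2 * (\<Sum>c<k. T (Suc c) * T (k - c)) - real k * (real N * T (Suc k)))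
      + \<beta> * real N / 2 * (real N * T (Suc k) - real N * T k))" .
  have 4: "(\<Sum>c<k. T_prod N (add_mset (Suc c) (add_mset (k - c) (mset_on \<kappa> S))) z) = (\<Sum>c<k. T (Suc c) * T (k - c)) * F"
    by (simp add: F_def T_def sum_distrib_right mult.assoc)
  have 5: "(\<Sum>j\<in>S. real (\<kappa> j) * T_prod N (add_mset (\<kappa> j + k + 1) (mset_on \<kappa> (S - {j}))) z) = R"
    by (simp add: R_def T_def)
  have 6: "T_prod N (add_mset j (mset_on \<kappa> S)) z = T j * F" for j by (simp add: T_def F_def)
  show ?thesis
    unfolding F_def[symmetric] sum.distrib 1 2 3 4 5 6
    using N \<beta> by (simp add: field_simps power2_eq_square)
qed

text \<open>The hypothesis \<open>deg\<close> is the condition of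
  \<open>ws_integration_by_parts\<close> for the field x_i^(-k) times the product, whose pole order
  is bounded by the sum of all exponents.\<close>

lemma moment_loop_equation:
  fixes \<kappa> :: "nat \<Rightarrow> nat"
  assumes \<beta>: "\<beta> \<ge> 1" and fin: "finite S"
    and deg: "real (k + sum \<kappa> S) + 2 \<le> \<beta> * real N / 2"
  defines "m A \<equiv> ws_expect \<beta> N (T_prod N A)"
  shows "(1 + real k / real N * (1 - 2 / \<beta>)) * m (add_mset (Suc k) (mset_on \<kappa> S)) =
       m (add_mset k (mset_on \<kappa> S))
       + (\<Sum>c<k. m (add_mset (Suc c) (add_mset (k - c) (mset_on \<kappa> S))))
       + 2 / (\<beta> * (real N)\<^sup>2) * (\<Sum>j\<in>S. real (\<kappa> j) * m (add_mset (\<kappa> j + k + 1) (mset_on \<kappa> (S - {j}))))"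
proof -
  have N: "N > 0"
  proof (rule ccontr)
    assume "\<not> N > 0"
    then show False using deg of_nat_0_le_iff[of "k + sum \<kappa> S", where 'a = real] by simp
  qed
  define W where "W = ws_weight \<beta> N"
  define F where "F = T_prod N (mset_on \<kappa> S)"
  define G where "G i z = 1 / z i ^ k * F z" for i z
  define G' where "G' i z = - real k * (1 / z i ^ Suc k) * F z
     + 1 / z i ^ k * (\<Sum>j\<in>S. - (real (\<kappa> j) / real N) * (1 / z i ^ (\<kappa> j + 1)) * T_prod N (mset_on \<kappa> (S - {j})) z)" for i z
  have rem: "sum \<kappa> S = \<kappa> j + sum \<kappa> (S - {j})" if "j \<in> S" for j using fin that by (rule sum.remove)
  have domF: "dominated N (sum \<kappa> S) F"
    unfolding F_def using dominated_T_prod[of N "mset_on \<kappa> S"] by (simp add: sum_mset_mset_on)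
  have domG: "dominated N (k + sum \<kappa> S) (G i)" if "i < N" for i
    unfolding G_def by (intro dominated_mult dominated_inverse_power domF that)
  have domG': "dominated N (Suc (k + sum \<kappa> S)) (G' i)" if "i < N" for i
    unfolding G'_def
  proof (rule dominated_add)
    have "dominated N (Suc k + sum \<kappa> S) (\<lambda>z. - real k * (1 / z i ^ Suc k) * F z)"
      by (intro dominated_mult dominated_cmult dominated_inverse_power domF that)
    then show "dominated N (Suc (k + sum \<kappa> S)) (\<lambda>z. - real k * (1 / z i ^ Suc k) * F z)" by simp
    have "dominated N (k + Suc (sum \<kappa> S)) (\<lambda>z. 1 / z i ^ k * (\<Sum>j\<in>S. - (real (\<kappa> j) / real N) * (1 / z i ^ (\<kappa> j + 1)) * T_prod N (mset_on \<kappa> (S - {j})) z))"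
    proof (intro dominated_mult dominated_inverse_power that dominated_sum)
      fix j assume j: "j \<in> S"
      have "dominated N (\<kappa> j + 1 + sum_mset (mset_on \<kappa> (S - {j})))
         (\<lambda>z. - (real (\<kappa> j) / real N) * (1 / z i ^ (\<kappa> j + 1)) * T_prod N (mset_on \<kappa> (S - {j})) z)"
        by (intro dominated_mult[OF dominated_cmult] dominated_inverse_power dominated_T_prod that)
      then show "dominated N (Suc (sum \<kappa> S)) (\<lambda>z. - (real (\<kappa> j) / real N) * (1 / z i ^ (\<kappa> j + 1)) * T_prod N (mset_on \<kappa> (S - {j})) z)"
        using rem[OF j] by (simp add: sum_mset_mset_on)
    qed
    then show "dominated N (Suc (k + sum \<kappa> S)) (\<lambda>z. 1 / z i ^ k * (\<Sum>j\<in>S. - (real (\<kappa> j) / real N) * (1 / z i ^ (\<kappa> j + 1)) * T_prod N (mset_on \<kappa> (S - {j})) z))"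
      by simp
  qed
  have deriv: "((\<lambda>y. G i (x(i := y))) has_real_derivative G' i (x(i := y))) (at y)" if "y > 0" "i < N" for i x y
  proof -
    have dF: "((\<lambda>y. F (x(i := y))) has_real_derivative
        (\<Sum>j\<in>S. - (real (\<kappa> j) / real N) * (1 / y ^ (\<kappa> j + 1)) * T_prod N (mset_on \<kappa> (S - {j})) (x(i := y)))) (at y)"
      unfolding F_def T_prod_mset_on
      by (rule has_field_derivative_prod) (rule ws_T_has_derivative[OF that(2,1)])
    have dI: "((\<lambda>y. 1 / y ^ k) has_real_derivative - real k * (1 / y ^ Suc k)) (at y)"
      using that(1) by (intro has_real_derivative_inverse_power) simp
    show ?thesis
      unfolding G_def G'_def fun_upd_same
      by (rule DERIV_cong[OF DERIV_mult'[OF dI dF]]) (rule add.commute)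
  qed
  define J where "J A = (\<integral>x. T_prod N A x * W x \<partial>ws_space N)" for A
  have intT: "integrable (ws_space N) (\<lambda>x. T_prod N A x * W x)" if "sum_mset A \<le> Suc (k + sum \<kappa> S)" for A
    unfolding W_def using that deg by (intro integrable_T_prod \<beta>) linarith
  define f where "f i x = G' i x * W x + G i x * (W x * ws_drift \<beta> N i x)" for i x
  have f: "integrable (ws_space N) (f i)" "(\<integral>x. f i x \<partial>ws_space N) = 0" if "i < N" for i
    unfolding f_def W_def
    using ws_integration_by_parts[OF \<beta> deg that domG[OF that] domG'[OF that] deriv[OF _ that]] by auto
  define r where "r = 1 + real k / real N * (1 - 2 / \<beta>)"
  define e where "e = 2 / (\<beta> * (real N)\<^sup>2)"
  define L where "L x = r * (T_prod N (add_mset (Suc k) (mset_on \<kappa> S)) x * W x)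
         - T_prod N (add_mset k (mset_on \<kappa> S)) x * W x
         - (\<Sum>c<k. T_prod N (add_mset (Suc c) (add_mset (k - c) (mset_on \<kappa> S))) x * W x)
         - e * (\<Sum>j\<in>S. real (\<kappa> j) * (T_prod N (add_mset (\<kappa> j + k + 1) (mset_on \<kappa> (S - {j}))) x * W x))" for x
  \<comment> \<open>The integrands agree everywhere: where the density vanishes both sides are 0,
    elsewhere \<open>sum_T_vector_field\<close> applies.\<close>
  have fL: "(\<Sum>i<N. f i x) = \<beta> * (real N)\<^sup>2 / 2 * L x" for x
  proof (cases "W x = 0")
    case True
    then show ?thesis by (simp add: f_def L_def)
  next
    case False
    have "(\<Sum>i<N. f i x) = (\<Sum>i<N. G' i x + G i x * ws_drift \<beta> N i x) * W x"
      unfolding f_def sum_distrib_right by (rule sum.cong) (auto simp: algebra_simps)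
    also have "\<dots> = (\<beta> * (real N)\<^sup>2 / 2 *
        (r * T_prod N (add_mset (Suc k) (mset_on \<kappa> S)) x
         - T_prod N (add_mset k (mset_on \<kappa> S)) x
         - (\<Sum>c<k. T_prod N (add_mset (Suc c) (add_mset (k - c) (mset_on \<kappa> S))) x)
         - e * (\<Sum>j\<in>S. real (\<kappa> j) * T_prod N (add_mset (\<kappa> j + k + 1) (mset_on \<kappa> (S - {j}))) x))) * W x"
      unfolding G_def G'_def F_def r_def e_def using False \<beta>
      by (subst sum_T_vector_field[OF N _ fin]) (auto simp: W_def)
    also have "\<dots> = \<beta> * (real N)\<^sup>2 / 2 * L x"
      unfolding L_def by (simp only: sum_distrib_right left_diff_distrib mult.assoc)
    finally show ?thesis .
  qed
  have "\<beta> * (real N)\<^sup>2 / 2 * (\<integral>x. L x \<partial>ws_space N) = (\<integral>x. (\<Sum>i<N. f i x) \<partial>ws_space N)"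
    unfolding fL by simp
  also have "\<dots> = (\<Sum>i<N. \<integral>x. f i x \<partial>ws_space N)"
    by (rule Bochner_Integration.integral_sum) (use f in auto)
  also have "\<dots> = 0" using f by simp
  finally have "(\<integral>x. L x \<partial>ws_space N) = 0" using \<beta> N by simp
  moreover have "(\<integral>x. L x \<partial>ws_space N) = r * J (add_mset (Suc k) (mset_on \<kappa> S)) - J (add_mset k (mset_on \<kappa> S))
       - (\<Sum>c<k. J (add_mset (Suc c) (add_mset (k - c) (mset_on \<kappa> S))))
       - e * (\<Sum>j\<in>S. real (\<kappa> j) * J (add_mset (\<kappa> j + k + 1) (mset_on \<kappa> (S - {j}))))"
  proof -
    have i1: "integrable (ws_space N) (\<lambda>x. T_prod N (add_mset (Suc k) (mset_on \<kappa> S)) x * W x)"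
      by (rule intT) (simp add: sum_mset_mset_on)
    have i2: "integrable (ws_space N) (\<lambda>x. T_prod N (add_mset k (mset_on \<kappa> S)) x * W x)"
      by (rule intT) (simp add: sum_mset_mset_on)
    have i3: "integrable (ws_space N) (\<lambda>x. T_prod N (add_mset (Suc c) (add_mset (k - c) (mset_on \<kappa> S))) x * W x)"
      if "c \<in> {..<k}" for c
      by (rule intT) (use that in \<open>simp add: sum_mset_mset_on\<close>)
    have i4: "integrable (ws_space N) (\<lambda>x. T_prod N (add_mset (\<kappa> j + k + 1) (mset_on \<kappa> (S - {j}))) x * W x)"
      if "j \<in> S" for j
      by (rule intT) (use rem[OF that] in \<open>simp add: sum_mset_mset_on\<close>)
    have s3: "integrable (ws_space N) (\<lambda>x. \<Sum>c<k. T_prod N (add_mset (Suc c) (add_mset (k - c) (mset_on \<kappa> S))) x * W x)"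
      by (rule Bochner_Integration.integrable_sum) (rule i3)
    have i4': "integrable (ws_space N) (\<lambda>x. real (\<kappa> j) * (T_prod N (add_mset (\<kappa> j + k + 1) (mset_on \<kappa> (S - {j}))) x * W x))"
      if "j \<in> S" for j
      by (rule integrable_mult_right[OF i4[OF that]])
    have s4: "integrable (ws_space N) (\<lambda>x. e * (\<Sum>j\<in>S. real (\<kappa> j) * (T_prod N (add_mset (\<kappa> j + k + 1) (mset_on \<kappa> (S - {j}))) x * W x)))"
      by (rule integrable_mult_right, rule Bochner_Integration.integrable_sum) (rule i4')
    have r1: "integrable (ws_space N) (\<lambda>x. r * (T_prod N (add_mset (Suc k) (mset_on \<kappa> S)) x * W x))"
      by (rule integrable_mult_right[OF i1])
    note d1 = Bochner_Integration.integrable_diff[OF r1 i2]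
    note d2 = Bochner_Integration.integrable_diff[OF d1 s3]
    have "(\<integral>x. L x \<partial>ws_space N) =
        r * J (add_mset (Suc k) (mset_on \<kappa> S)) - J (add_mset k (mset_on \<kappa> S))
       - (\<integral>x. (\<Sum>c<k. T_prod N (add_mset (Suc c) (add_mset (k - c) (mset_on \<kappa> S))) x * W x) \<partial>ws_space N)
       - e * (\<integral>x. (\<Sum>j\<in>S. real (\<kappa> j) * (T_prod N (add_mset (\<kappa> j + k + 1) (mset_on \<kappa> (S - {j}))) x * W x)) \<partial>ws_space N)"
      unfolding L_def J_def
      unfolding Bochner_Integration.integral_diff[OF d2 s4] Bochner_Integration.integral_diff[OF d1 s3]
        Bochner_Integration.integral_diff[OF r1 i2] integral_mult_right_zero ..
    moreover have "(\<integral>x. (\<Sum>c<k. T_prod N (add_mset (Suc c) (add_mset (k - c) (mset_on \<kappa> S))) x * W x) \<partial>ws_space N)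
        = (\<Sum>c<k. J (add_mset (Suc c) (add_mset (k - c) (mset_on \<kappa> S))))"
      unfolding J_def by (rule Bochner_Integration.integral_sum) (rule i3)
    moreover have "(\<integral>x. (\<Sum>j\<in>S. real (\<kappa> j) * (T_prod N (add_mset (\<kappa> j + k + 1) (mset_on \<kappa> (S - {j}))) x * W x)) \<partial>ws_space N)
        = (\<Sum>j\<in>S. real (\<kappa> j) * J (add_mset (\<kappa> j + k + 1) (mset_on \<kappa> (S - {j}))))"
      unfolding J_def integral_mult_right_zero[symmetric]
      by (rule Bochner_Integration.integral_sum) (rule i4')
    ultimately show ?thesis by (simp only:)
  qed
  ultimately have J: "r * J (add_mset (Suc k) (mset_on \<kappa> S)) = J (add_mset k (mset_on \<kappa> S))
       + (\<Sum>c<k. J (add_mset (Suc c) (add_mset (k - c) (mset_on \<kappa> S))))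
       + e * (\<Sum>j\<in>S. real (\<kappa> j) * J (add_mset (\<kappa> j + k + 1) (mset_on \<kappa> (S - {j}))))" by simp
  define Z where "Z = (\<integral>x. W x \<partial>ws_space N)"
  have m: "m A = J A / Z" for A by (simp add: m_def ws_expect_def J_def Z_def W_def)
  have "r * J (add_mset (Suc k) (mset_on \<kappa> S)) / Z = (J (add_mset k (mset_on \<kappa> S))
       + (\<Sum>c<k. J (add_mset (Suc c) (add_mset (k - c) (mset_on \<kappa> S))))
       + e * (\<Sum>j\<in>S. real (\<kappa> j) * J (add_mset (\<kappa> j + k + 1) (mset_on \<kappa> (S - {j}))))) / Z"
    using J by simp
  then show ?thesis
    unfolding r_def[symmetric] e_def[symmetric] m
    by (simp add: add_divide_distrib flip: sum_divide_distrib)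
qed

section \<open>Limits of the rescaled cumulants\<close>

text \<open>A positive total mass makes the empty moment equal to 1, on which the inversion of the
  moment-cumulant relation rests.\<close>

lemma ws_partition_function_pos:
  assumes \<beta>: "\<beta> \<ge> 1" and N: "1 \<le> \<beta> * real N / 2"
  shows "(\<integral>x. ws_weight \<beta> N x \<partial>ws_space N) > 0"
proof -
  interpret product_sigma_finite "\<lambda>_::nat. lborel :: real measure" by (rule ws_space_sigma)
  have int: "integrable (ws_space N) (ws_weight \<beta> N)"
    using integrable_dominated(1)[OF \<beta> _ dominated_const[of N 1]] N by simp
  \<comment> \<open>Unit intervals to the right of 0, separated by gaps of length 1: on this box of
    measure 1 all coordinates are positive and distinct.\<close>
  define B where "B = (\<Pi>\<^sub>E i\<in>{..<N}. {2 * real i + 1 .. 2 * real i + 2})"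
  have B: "B \<in> sets (ws_space N)"
    unfolding B_def ws_space_def by (rule sets_PiM_I_finite) auto
  have emB: "emeasure (ws_space N) B = 1"
    unfolding B_def ws_space_def by (subst emeasure_PiM) auto
  have wB: "ws_weight \<beta> N x \<noteq> 0" if "x \<in> B" for x
  proof -
    have x: "2 * real i + 1 \<le> x i" "x i \<le> 2 * real i + 2" if "i < N" for i
      using \<open>x \<in> B\<close> that by (auto simp: B_def PiE_iff)
    have pos: "\<forall>i<N. x i > 0"
    proof (intro allI impI)
      fix i assume "i < N"
      then show "x i > 0" using x(1)[of i] of_nat_0_le_iff[of i, where 'a = real] by linarith
    qed
    have "x i \<noteq> x j" if "i < j" "j < N" for i j
    proof -
      have "real i + 1 \<le> real j" using that by simp
      then show ?thesis using x(2)[of i] x(1)[of j] that by linarith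
    qed
    then have "vandermonde_power \<beta> N x \<noteq> 0" by (auto simp: prod_zero_iff)
    moreover have "(\<Prod>k<N. x k powr (\<beta> * real N / 2) * exp (- (\<beta> * real N / 2) * x k)) \<noteq> 0"
      using pos by (force simp: prod_zero_iff)
    ultimately show ?thesis by (simp add: ws_weight_on_orthant[OF pos])
  qed
  have "(\<integral>x. ws_weight \<beta> N x \<partial>ws_space N) \<noteq> 0"
  proof
    assume "(\<integral>x. ws_weight \<beta> N x \<partial>ws_space N) = 0"
    then have "AE x in ws_space N. ws_weight \<beta> N x = 0"
      using integral_nonneg_eq_0_iff_AE[OF int] ws_weight_nonneg by auto
    then have "AE x in ws_space N. x \<notin> B" by eventually_elim (use wB in blast)
    then have "emeasure (ws_space N) B = 0" 
      using AE_iff_measurable[OF B, of "\<lambda>x. x \<notin> B"] sets.sets_into_space[OF B] by auto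
    then show False using emB by simp
  qed
  moreover have "(\<integral>x. ws_weight \<beta> N x \<partial>ws_space N) \<ge> 0"
    by (rule Bochner_Integration.integral_nonneg) (simp add: ws_weight_nonneg)
  ultimately show ?thesis by simp
qed

definition ws_moment :: "real \<Rightarrow> nat \<Rightarrow> nat multiset \<Rightarrow> real" where
  "ws_moment \<beta> N A = ws_expect \<beta> N (T_prod N A)"

lemma ws_moment_empty:
  assumes "\<beta> \<ge> 1" "1 \<le> \<beta> * real N / 2"
  shows "ws_moment \<beta> N {#} = 1"
  using ws_partition_function_pos[OF assms] by (simp add: ws_moment_def ws_expect_def)

lemma ws_moment_zero: "N > 0 \<Longrightarrow> ws_moment \<beta> N (add_mset 0 A) = ws_moment \<beta> N A"
  by (simp add: ws_moment_def ws_T_def)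

lemma ws_cumulant_eq_mcum: "ws_cumulant \<beta> N ks = mcum (ws_moment \<beta> N) (mset ks)"
proof -
  have "ws_cumulant \<beta> N ks = cum (\<lambda>P. ws_moment \<beta> N (mset_on ((!) ks) P)) {..<length ks}"
    by (simp add: ws_cumulant_def cum_def ws_moment_def T_prod_mset_on)
  then show ?thesis by (simp add: cum_mset_on mset_on_nth)
qed

definition scaled_cumulant :: "real \<Rightarrow> nat \<Rightarrow> nat multiset \<Rightarrow> real" where
  "scaled_cumulant \<beta> N A = (\<beta> * (real N)\<^sup>2) ^ (size A - 1) * mcum (ws_moment \<beta> N) A"

text \<open>Power counting with h = \<beta> N^2 and n = card S. The two cumulants of a product
  together carry h^n, as the left side does; c[a, b, S] carries h^(n+1), whence the factor 1/h;
  after the removal of an index the power is h^(n-1), and the missing h cancels the one in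
  2/h.\<close>

lemma scaled_cumulant_loop_equation:
  fixes \<kappa> :: "nat \<Rightarrow> nat"
  assumes \<beta>: "\<beta> \<ge> 1" and fin: "finite S" and deg: "real (k + sum \<kappa> S) + 2 \<le> \<beta> * real N / 2"
  defines "c \<equiv> scaled_cumulant \<beta> N"
  shows "(1 + real k / real N * (1 - 2 / \<beta>)) * c (add_mset (Suc k) (mset_on \<kappa> S)) =
       c (add_mset k (mset_on \<kappa> S))
       + (\<Sum>a<k. 1 / (\<beta> * (real N)\<^sup>2) * c (add_mset (Suc a) (add_mset (k - a) (mset_on \<kappa> S)))
           + (\<Sum>I\<in>Pow S. c (add_mset (Suc a) (mset_on \<kappa> I)) * c (add_mset (k - a) (mset_on \<kappa> (S - I)))))
       + 2 * (\<Sum>j\<in>S. real (\<kappa> j) * c (add_mset (\<kappa> j + k + 1) (mset_on \<kappa> (S - {j}))))"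
proof -
  define h where "h = \<beta> * (real N)\<^sup>2"
  define r where "r = 1 + real k / real N * (1 - 2 / \<beta>)"
  define m where "m = ws_moment \<beta> N"
  define n where "n = card S"
  have deg0: "1 \<le> \<beta> * real N / 2"
    using deg of_nat_0_le_iff[of "k + sum \<kappa> S", where 'a = real] by linarith
  then have "N > 0" by (cases N) auto
  then have h: "h > 0" using \<beta> by (simp add: h_def)
  have loop: "r * m (add_mset (Suc k) (mset_on \<kappa> R)) =
       m (add_mset k (mset_on \<kappa> R))
       + (\<Sum>c<k. m (add_mset (Suc c) (add_mset (k - c) (mset_on \<kappa> R))))
       + 2 / h * (\<Sum>j\<in>R. real (\<kappa> j) * m (add_mset (\<kappa> j + k + 1) (mset_on \<kappa> (R - {j}))))" if "R \<subseteq> S" for R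
  proof -
    have "sum \<kappa> R \<le> sum \<kappa> S" using fin that by (intro sum_mono2) auto
    then have "real (k + sum \<kappa> R) + 2 \<le> \<beta> * real N / 2" using deg by linarith
    then show ?thesis
      unfolding m_def ws_moment_def r_def h_def
      using moment_loop_equation[OF \<beta> finite_subset[OF that fin]] by blast
  qed
  have main: "r * mcum m (add_mset (Suc k) (mset_on \<kappa> S)) =
       mcum m (add_mset k (mset_on \<kappa> S))
       + (\<Sum>c<k. mcum m (add_mset (Suc c) (add_mset (k - c) (mset_on \<kappa> S)))
           + (\<Sum>I\<in>Pow S. mcum m (add_mset (Suc c) (mset_on \<kappa> I)) * mcum m (add_mset (k - c) (mset_on \<kappa> (S - I)))))
       + 2 / h * (\<Sum>j\<in>S. real (\<kappa> j) * mcum m (add_mset (\<kappa> j + k + 1) (mset_on \<kappa> (S - {j}))))"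
    using fin ws_moment_empty[OF \<beta> deg0] loop unfolding m_def by (rule mcum_loop_equation)
  have c1: "c (add_mset a (mset_on \<kappa> S)) = h ^ n * mcum m (add_mset a (mset_on \<kappa> S))" for a
    by (simp add: c_def scaled_cumulant_def h_def m_def n_def size_mset_on)
  have c2: "1 / h * c (add_mset a (add_mset b (mset_on \<kappa> S))) = h ^ n * mcum m (add_mset a (add_mset b (mset_on \<kappa> S)))" for a b
    using h by (simp add: c_def scaled_cumulant_def h_def[symmetric] m_def n_def size_mset_on)
  have c3: "c (add_mset a (mset_on \<kappa> I)) * c (add_mset b (mset_on \<kappa> (S - I)))
      = h ^ n * (mcum m (add_mset a (mset_on \<kappa> I)) * mcum m (add_mset b (mset_on \<kappa> (S - I))))" if "I \<in> Pow S" for a b I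
  proof -
    have "n = card I + card (S - I)"
      using that fin finite_subset[of I S] card_mono[of S I] by (simp add: n_def card_Diff_subset)
    then show ?thesis
      by (simp add: c_def scaled_cumulant_def h_def[symmetric] m_def size_mset_on power_add mult_ac)
  qed
  have c4: "2 * c (add_mset a (mset_on \<kappa> (S - {j}))) = h ^ n * (2 / h * mcum m (add_mset a (mset_on \<kappa> (S - {j}))))" if "j \<in> S" for a j
  proof -
    have "n = Suc (card (S - {j}))" using fin that by (simp add: n_def card_Suc_Diff1 del: card_Diff_insert)
    then show ?thesis using h by (simp add: c_def scaled_cumulant_def h_def[symmetric] m_def size_mset_on)
  qed
  have "r * c (add_mset (Suc k) (mset_on \<kappa> S)) = h ^ n * (r * mcum m (add_mset (Suc k) (mset_on \<kappa> S)))"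
    by (simp add: c1)
  also have "\<dots> = h ^ n * mcum m (add_mset k (mset_on \<kappa> S))
       + (\<Sum>a<k. h ^ n * mcum m (add_mset (Suc a) (add_mset (k - a) (mset_on \<kappa> S)))
           + (\<Sum>I\<in>Pow S. h ^ n * (mcum m (add_mset (Suc a) (mset_on \<kappa> I)) * mcum m (add_mset (k - a) (mset_on \<kappa> (S - I))))))
       + (\<Sum>j\<in>S. real (\<kappa> j) * (h ^ n * (2 / h * mcum m (add_mset (\<kappa> j + k + 1) (mset_on \<kappa> (S - {j}))))))"
    unfolding main by (simp add: distrib_left sum_distrib_left sum.distrib mult_ac)
  also have "\<dots> = c (add_mset k (mset_on \<kappa> S))
       + (\<Sum>a<k. 1 / h * c (add_mset (Suc a) (add_mset (k - a) (mset_on \<kappa> S)))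
           + (\<Sum>I\<in>Pow S. c (add_mset (Suc a) (mset_on \<kappa> I)) * c (add_mset (k - a) (mset_on \<kappa> (S - I)))))
       + (\<Sum>j\<in>S. real (\<kappa> j) * (2 * c (add_mset (\<kappa> j + k + 1) (mset_on \<kappa> (S - {j})))))"
    by (simp only: c1 c2 c3 c4 cong: sum.cong)
  finally show ?thesis
    unfolding r_def h_def by (simp add: sum_distrib_left mult_ac)
qed

lemma scaled_cumulant_limit:
  assumes \<beta>: "\<beta> \<ge> 1" and A: "A \<noteq> {#}"
  shows "\<exists>n::nat. (\<lambda>N. scaled_cumulant \<beta> N A) \<longlonglongrightarrow> real n"
proof (rule loop_equation_limits[OF _ _ _ _ A, where r = "\<lambda>k N. 1 + real k / real N * (1 - 2 / \<beta>)"
      and \<epsilon> = "\<lambda>N. 1 / (\<beta> * (real N)\<^sup>2)"])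
  \<comment> \<open>As \<beta> \<ge> 1, it suffices that N \<ge> 2 d + 4, so each condition on the
    degree holds eventually.\<close>
  have large: "\<forall>\<^sub>F N in sequentially. real d + 2 \<le> \<beta> * real N / 2" for d :: nat
    using eventually_ge_at_top[of "2 * d + 4"]
  proof eventually_elim
    case (elim N)
    have "real (2 * d + 4) \<le> real N" using elim by (simp only: of_nat_le_iff)
    moreover have "real N \<le> \<beta> * real N" using \<beta> by (simp add: mult_le_cancel_right1)
    ultimately have "real (2 * d + 4) \<le> \<beta> * real N" by (rule order_trans)
    then show ?case by simp
  qed
  show "(\<lambda>N. 1 + real k / real N * (1 - 2 / \<beta>)) \<longlonglongrightarrow> 1" for k
  proof -
    have "(\<lambda>N. 1 + real k / real N * (1 - 2 / \<beta>)) \<longlonglongrightarrow> 1 + 0 * (1 - 2 / \<beta>)"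
      by (intro tendsto_intros lim_const_over_n)
    then show ?thesis by simp
  qed
  show "(\<lambda>N. 1 / (\<beta> * (real N)\<^sup>2)) \<longlonglongrightarrow> 0"
  proof -
    have "(\<lambda>N. 1 / \<beta> * (1 / real N) ^ 2) \<longlonglongrightarrow> 1 / \<beta> * 0 ^ 2"
      by (intro tendsto_intros lim_const_over_n)
    then show ?thesis by (simp add: power_one_over)
  qed
  show "(\<lambda>N. scaled_cumulant \<beta> N (add_mset 0 B)) \<longlonglongrightarrow> (if B = {#} then 1 else 0)" for B
  proof (rule tendsto_eventually)
    show "\<forall>\<^sub>F N in sequentially. scaled_cumulant \<beta> N (add_mset 0 B) = (if B = {#} then 1 else 0)"
      using large[of 0] eventually_gt_at_top[of 0]
    proof eventually_elim
      case (elim N)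
      then have "ws_moment \<beta> N {#} = 1" by (intro ws_moment_empty \<beta>) auto
      then have "mcum (ws_moment \<beta> N) (add_mset 0 B) = (if B = {#} then 1 else 0)"
        using elim(2) by (intro mcum_trivial_variable ws_moment_zero)
      then show ?case by (simp add: scaled_cumulant_def)
    qed
  qed
  show "\<forall>\<^sub>F N in sequentially.
       (1 + real k / real N * (1 - 2 / \<beta>)) * scaled_cumulant \<beta> N (add_mset (Suc k) (mset_on \<kappa> S)) =
       scaled_cumulant \<beta> N (add_mset k (mset_on \<kappa> S))
       + (\<Sum>a<k. 1 / (\<beta> * (real N)\<^sup>2) * scaled_cumulant \<beta> N (add_mset (Suc a) (add_mset (k - a) (mset_on \<kappa> S)))
           + (\<Sum>I\<in>Pow S. scaled_cumulant \<beta> N (add_mset (Suc a) (mset_on \<kappa> I)) *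
                scaled_cumulant \<beta> N (add_mset (k - a) (mset_on \<kappa> (S - I)))))
       + 2 * (\<Sum>j\<in>S. real (\<kappa> j) * scaled_cumulant \<beta> N (add_mset (\<kappa> j + k + 1) (mset_on \<kappa> (S - {j}))))"
    if "finite S" for \<kappa> and S :: "nat set" and k
    using large[of "k + sum \<kappa> S"]
    by eventually_elim (rule scaled_cumulant_loop_equation[OF \<beta> that])
qed

lemma alpha_in_Nat_nonempty:
  assumes "\<beta> \<ge> 1" "ks \<noteq> []"
  shows "alpha_in_Nat \<beta> ks"
proof -
  obtain n :: nat where "(\<lambda>N. scaled_cumulant \<beta> N (mset ks)) \<longlonglongrightarrow> real n"
    using scaled_cumulant_limit[of \<beta> "mset ks"] assms by auto
  then show ?thesis
    unfolding alpha_in_Nat_def scaled_cumulant_def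
    by (auto simp: ws_cumulant_eq_mcum power_mult_distrib power_mult)
qed

theorem theorem2:
  fixes \<beta> :: real
  assumes "\<beta> \<in> {1, 2, 4}"
  shows "(\<forall>\<kappa>. alpha_in_Nat \<beta> [\<kappa>])
       \<and> (\<forall>\<kappa>1 \<kappa>2. alpha_in_Nat \<beta> [\<kappa>1, \<kappa>2])
       \<and> (\<forall>\<kappa>1 \<kappa>2 \<kappa>3. alpha_in_Nat \<beta> [\<kappa>1, \<kappa>2, \<kappa>3])
       \<and> (\<forall>v\<ge>1. alpha_in_Nat \<beta> (replicate v 1))"
proof -
  have "\<beta> \<ge> 1" using assms by auto
  then show ?thesis by (auto intro!: alpha_in_Nat_nonempty)
qed

end
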